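(* Fix a positive integer $q$ and an arbitrary $\epsilon>0$. Let $P_n$ be a random many-to-one school choice problem with $n$ schools of quota $q$ and $nq$ students. With probability tending to $1$ as $n\to\infty$, the envy digraph $G^{\mathrm{DA}(P_n)}$ has a strongly connected component containing at least $(1-\epsilon)nq$ students.
   Context: A random many-to-one school choice problem $P_n$ with quota $q$: a set $S$ of $n$ schools, each with quota $q$, and a set $I$ of $nq$ students; each student's strict preference over $S$ is a uniformly random linear order, each school's strict priority over $I$ is a uniformly random linear order, all mutually independent. $\mathrm{DA}(P_n)$ is the matching produced by student-proposing deferred acceptance: in each round every student not tentatively held applies to her most preferred school that has not yet rejected her; each school tentatively holds its $q$ highest-priority applicants (new and previously held) and rejects the rest; stop when a round has no new rejection. The envy digraph $G^{\mathrm{DA}(P_n)}$ has vertex set $I$ and a directed edge $(i,j)$ iff $i$ strictly prefers $\mathrm{DA}_j(P_n)$ to $\mathrm{DA}_i(P_n)$. A strongly connected component is a maximal set of vertices such that each ordered pair of them is joined by a directed path. *)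

theory Defs
  imports "HOL-Analysis.Analysis" "HOL-Combinatorics.Permutations" "HOL-Library.FuncSet"
begin

text \<open>Schools are 0..<n, students are 0..<n*q.
 A strict preference of a student is a permutation p of {..<n}: p k is the school she ranks
 at position k (position 0 = most preferred); so her rank of school s is inv p s.
 A strict priority of school s is a permutation of {..<n*q}: Q s k is the student at
 position k (position 0 = highest priority).\<close>

definition profiles :: "nat \<Rightarrow> nat \<Rightarrow> ((nat \<Rightarrow> nat \<Rightarrow> nat) \<times> (nat \<Rightarrow> nat \<Rightarrow> nat)) set" where
  "profiles n q =
     (PiE {..<n*q} (\<lambda>_. {p. p permutes {..<n}})) \<times> (PiE {..<n} (\<lambda>_. {p. p permutes {..<n*q}}))"

text \<open>A DA state r records, for each student, how many schools have rejected her so far;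
 her current (tentative) school is P i (r i). One round: every student applies to / stays at
 her current school; each school keeps its q highest-priority applicants and rejects the rest.\<close>

definition da_rejected :: "nat \<Rightarrow> nat \<Rightarrow> (nat \<Rightarrow> nat \<Rightarrow> nat) \<Rightarrow> (nat \<Rightarrow> nat \<Rightarrow> nat)
    \<Rightarrow> (nat \<Rightarrow> nat) \<Rightarrow> nat \<Rightarrow> bool" where
  "da_rejected n q P Q r i \<longleftrightarrow> i < n*q \<and> r i < n \<and>
     q \<le> card {j. j < n*q \<and> r j < n \<and> P j (r j) = P i (r i) \<and>
                 inv (Q (P i (r i))) j < inv (Q (P i (r i))) i}"

definition da_step :: "nat \<Rightarrow> nat \<Rightarrow> (nat \<Rightarrow> nat \<Rightarrow> nat) \<Rightarrow> (nat \<Rightarrow> nat \<Rightarrow> nat)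
    \<Rightarrow> (nat \<Rightarrow> nat) \<Rightarrow> (nat \<Rightarrow> nat)" where
  "da_step n q P Q r = (\<lambda>i. if da_rejected n q P Q r i then Suc (r i) else r i)"

text \<open>Run rounds from the initial state until a round has no new rejection.\<close>
definition da_final :: "nat \<Rightarrow> nat \<Rightarrow> (nat \<Rightarrow> nat \<Rightarrow> nat) \<Rightarrow> (nat \<Rightarrow> nat \<Rightarrow> nat) \<Rightarrow> (nat \<Rightarrow> nat)" where
  "da_final n q P Q =
     (let k = (LEAST k. \<forall>i. \<not> da_rejected n q P Q ((da_step n q P Q ^^ k) (\<lambda>_. 0)) i)
      in (da_step n q P Q ^^ k) (\<lambda>_. 0))"

text \<open>The DA matching: school assigned to student i.\<close>
definition DA :: "nat \<Rightarrow> nat \<Rightarrow> (nat \<Rightarrow> nat \<Rightarrow> nat) \<Rightarrow> (nat \<Rightarrow> nat \<Rightarrow> nat) \<Rightarrow> nat \<Rightarrow> nat" where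
  "DA n q P Q i = P i (da_final n q P Q i)"

text \<open>Envy digraph: edge (i,j) iff i strictly prefers DA j to DA i.\<close>
definition envy_edges :: "nat \<Rightarrow> nat \<Rightarrow> (nat \<Rightarrow> nat \<Rightarrow> nat) \<Rightarrow> (nat \<Rightarrow> nat \<Rightarrow> nat) \<Rightarrow> (nat \<times> nat) set" where
  "envy_edges n q P Q = {(i, j). i < n*q \<and> j < n*q \<and>
      inv (P i) (DA n q P Q j) < inv (P i) (DA n q P Q i)}"

text \<open>Strongly connected component of digraph (V, E).\<close>
definition strongly_connected_set :: "'a set \<Rightarrow> ('a \<times> 'a) set \<Rightarrow> 'a set \<Rightarrow> bool" where
  "strongly_connected_set V E C \<longleftrightarrow> C \<subseteq> V \<and> (\<forall>x\<in>C. \<forall>y\<in>C. (x, y) \<in> (E \<inter> V \<times> V)\<^sup>*)"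

definition is_scc :: "'a set \<Rightarrow> ('a \<times> 'a) set \<Rightarrow> 'a set \<Rightarrow> bool" where
  "is_scc V E C \<longleftrightarrow> C \<noteq> {} \<and> strongly_connected_set V E C \<and>
     (\<forall>D. C \<subseteq> D \<and> strongly_connected_set V E D \<longrightarrow> D = C)"

end

theory Submission
  imports Defs "HOL-Real_Asymp.Real_Asymp"
begin

text \<open>
  Write \<open>N = n q\<close>. If there is no large strongly connected component, some set \<open>S\<close> of students that is
  closed under envy contains neither almost none nor almost all of them. No student of \<open>S\<close> has been
  rejected by a school of the set \<open>T\<close> of schools attended outside \<open>S\<close>. If all but few students have
  been rejected at least \<open>k\<close> times, this makes linearly many students have their first \<open>k\<close> choices
  outside the linearly large set \<open>T\<close>; for \<open>k\<close> large a union bound over all pairs of sets shows that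
  this is exponentially unlikely.

  It remains to see that, for fixed \<open>k\<close>, few students are rejected less than \<open>k\<close> times. Cutting all
  preference lists after a large constant number \<open>K\<close> of entries only removes rejections. For a given
  vector \<open>r\<close> of rejection counts, let \<open>M\<close> be the number of applications and \<open>A\<close> the number of accepted
  ones. Truncation makes the choices independent up to a constant factor, and a school with \<open>e\<close>
  applicants accepts a uniformly random set of \<open>min q e\<close> of them; by exchangeability the probability of
  \<open>r\<close> is at most a constant times \<open>1 / (M choose A)\<close> times the probability that \<open>M\<close> balls in \<open>n\<close> bins
  of capacity \<open>q\<close> leave exactly \<open>A\<close> balls. Up to a factor \<open>M + 1\<close>, \<open>1 / (M choose A)\<close> is the weight of
  \<open>r\<close> under independent geometric variables with success rate \<open>A / M\<close>, truncated at \<open>K\<close>. If \<open>M \<ge> \<lambda> n\<close>,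
  the rate is at most \<open>q / \<lambda>\<close> and few variables are below \<open>k\<close>. If \<open>M < \<lambda> n\<close>, at most \<open>\<lambda> n / K\<close> students
  have used up their lists, so almost no bin is empty, which is exponentially unlikely.
\<close>

section \<open>Truncated deferred acceptance\<close>

text \<open>Deferred acceptance with every preference list cut off after its first \<open>c\<close> entries: in a state
  \<open>r\<close>, \<open>r i = c\<close> means that student \<open>i\<close> has dropped out. The untruncated algorithm is \<open>c = n\<close>.\<close>

definition cap_rejected :: "nat \<Rightarrow> nat \<Rightarrow> nat \<Rightarrow> (nat \<Rightarrow> nat \<Rightarrow> nat) \<Rightarrow> (nat \<Rightarrow> nat \<Rightarrow> nat)
    \<Rightarrow> (nat \<Rightarrow> nat) \<Rightarrow> nat \<Rightarrow> bool" where
  "cap_rejected c N q P Q r i \<longleftrightarrow> i < N \<and> r i < c \<and>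
     q \<le> card {j. j < N \<and> r j < c \<and> P j (r j) = P i (r i) \<and>
                 inv (Q (P i (r i))) j < inv (Q (P i (r i))) i}"

definition cap_step :: "nat \<Rightarrow> nat \<Rightarrow> nat \<Rightarrow> (nat \<Rightarrow> nat \<Rightarrow> nat) \<Rightarrow> (nat \<Rightarrow> nat \<Rightarrow> nat)
    \<Rightarrow> (nat \<Rightarrow> nat) \<Rightarrow> (nat \<Rightarrow> nat)" where
  "cap_step c N q P Q r = (\<lambda>i. if cap_rejected c N q P Q r i then Suc (r i) else r i)"

lemma cap_step_apply:
  "cap_step c N q P Q r i = (if cap_rejected c N q P Q r i then Suc (r i) else r i)"
  by (simp add: cap_step_def)

definition cap_final :: "nat \<Rightarrow> nat \<Rightarrow> nat \<Rightarrow> (nat \<Rightarrow> nat \<Rightarrow> nat) \<Rightarrow> (nat \<Rightarrow> nat \<Rightarrow> nat)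
    \<Rightarrow> (nat \<Rightarrow> nat)" where
  "cap_final c N q P Q =
     (let k = (LEAST k. \<forall>i. \<not> cap_rejected c N q P Q ((cap_step c N q P Q ^^ k) (\<lambda>_. 0)) i)
      in (cap_step c N q P Q ^^ k) (\<lambda>_. 0))"

definition holders :: "nat \<Rightarrow> nat \<Rightarrow> (nat \<Rightarrow> nat \<Rightarrow> nat) \<Rightarrow> (nat \<Rightarrow> nat) \<Rightarrow> nat \<Rightarrow> nat set" where
  "holders c N P r s = {j. j < N \<and> r j < c \<and> P j (r j) = s}"

lemma da_final_eq_cap_final: "da_final n q P Q = cap_final n (n*q) q P Q"
proof -
  have r: "da_rejected n q P Q = cap_rejected n (n*q) q P Q"
    by (intro ext) (simp add: da_rejected_def cap_rejected_def)
  have s: "da_step n q P Q = cap_step n (n*q) q P Q"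
    by (intro ext) (simp add: da_step_def cap_step_def r)
  show ?thesis by (simp add: da_final_def cap_final_def r s)
qed

lemma finite_holders [simp]: "finite (holders c N P r s)"
  by (simp add: holders_def)

lemma cap_rejected_iff:
  "cap_rejected c N q P Q r i \<longleftrightarrow> i < N \<and> r i < c \<and>
     q \<le> card {j \<in> holders c N P r (P i (r i)). inv (Q (P i (r i))) j < inv (Q (P i (r i))) i}"
  unfolding cap_rejected_def holders_def by (simp add: conj_assoc)

lemma ex_max_on:
  fixes f :: "'a \<Rightarrow> nat"
  assumes "finite X" "X \<noteq> {}"
  shows "\<exists>m\<in>X. \<forall>y\<in>X. f y \<le> f m"
proof -
  have "Max (f ` X) \<in> f ` X" using assms by simp
  then obtain m where "m \<in> X" "f m = Max (f ` X)" by (metis imageE)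
  then show ?thesis using assms by (metis Max_ge finite_imageI imageI)
qed

text \<open>Induction on the size of \<open>X\<close>: an element of maximal value lies in no set
  \<open>{z \<in> X. f z < f y}\<close>, so it can be removed without changing these counts. Ties
  may leave more than \<open>q\<close> elements, hence the inequality.\<close>

lemma card_lowest_ge:
  fixes f :: "'a \<Rightarrow> nat"
  assumes "finite X" "q \<le> card X"
  shows "q \<le> card {y \<in> X. card {z \<in> X. f z < f y} < q}"
  using assms
proof (induction "card X" arbitrary: X rule: less_induct)
  case less
  show ?case
  proof (cases "card X = q")
    case True
    have "card {z \<in> X. f z < f y} < q" if "y \<in> X" for y
      using that True less.prems by (auto intro!: psubset_card_mono)
    then have "{y \<in> X. card {z \<in> X. f z < f y} < q} = X" by auto
    then show ?thesis using True by simp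
  next
    case False
    then have "X \<noteq> {}" using less.prems by auto
    then obtain m where m: "m \<in> X" "\<And>y. y \<in> X \<Longrightarrow> f y \<le> f m"
      using ex_max_on[OF less.prems(1)] by metis
    let ?X = "X - {m}"
    have c: "card ?X < card X" "q \<le> card ?X" using m less.prems False by (auto intro: card_Diff1_less)
    have "q \<le> card {y \<in> ?X. card {z \<in> ?X. f z < f y} < q}"
      using less.hyps[OF c(1) _ c(2)] less.prems by simp
    also have "\<dots> \<le> card {y \<in> X. card {z \<in> X. f z < f y} < q}"
    proof (rule card_mono)
      have "{z \<in> X. f z < f y} = {z \<in> ?X. f z < f y}" if "y \<in> X" for y
        using m(2)[OF that] by auto
      then show "{y \<in> ?X. card {z \<in> ?X. f z < f y} < q} \<subseteq> {y \<in> X. card {z \<in> X. f z < f y} < q}"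
        by auto
    qed (use less.prems in simp)
    finally show ?thesis .
  qed
qed

text \<open>The invariant of deferred acceptance: the best \<open>q\<close> applicants ahead of a
  threshold have fewer than \<open>q\<close> rivals ahead of them, so a round can only improve the
  standing of a school.\<close>

lemma better_holders_step:
  assumes "q \<le> card {l \<in> holders c N P r s. inv (Q s) l < x}"
  shows "q \<le> card {l \<in> holders c N P (cap_step c N q P Q r) s. inv (Q s) l < x}"
proof -
  let ?f = "inv (Q s)"
  let ?X = "{l \<in> holders c N P r s. ?f l < x}"
  \<comment> \<open>the \<open>q\<close> best members of \<open>?X\<close> survive the round\<close>
  have "q \<le> card {y \<in> ?X. card {z \<in> ?X. ?f z < ?f y} < q}"
    by (rule card_lowest_ge) (use assms in auto)
  also have "\<dots> \<le> card {l \<in> holders c N P (cap_step c N q P Q r) s. ?f l < x}"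
  proof (intro card_mono subsetI)
    fix y assume y: "y \<in> {y \<in> ?X. card {z \<in> ?X. ?f z < ?f y} < q}"
    then have "{z \<in> ?X. ?f z < ?f y} = {j \<in> holders c N P r s. ?f j < ?f y}" by auto
    with y have "\<not> cap_rejected c N q P Q r y"
      by (simp add: cap_rejected_iff holders_def linorder_not_le)
    with y show "y \<in> {l \<in> holders c N P (cap_step c N q P Q r) s. ?f l < x}"
      by (auto simp: holders_def cap_step_apply)
  qed simp
  finally show ?thesis .
qed

lemma cap_state_le: "(cap_step c N q P Q ^^ m) (\<lambda>_. 0) i \<le> c"
  by (induction m) (auto simp: cap_step_apply cap_rejected_def)

text \<open>Induction over the rounds: when \<open>i\<close> is rejected, the \<open>q\<close>
  better applicants are present by definition, and \<open>better_holders_step\<close> keeps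
  \<open>q\<close> such applicants ever after.\<close>

lemma rejecter_better_holders:
  assumes "i < N" "j < (cap_step c N q P Q ^^ m) (\<lambda>_. 0) i"
  shows "q \<le> card {l \<in> holders c N P ((cap_step c N q P Q ^^ m) (\<lambda>_. 0)) (P i j).
                 inv (Q (P i j)) l < inv (Q (P i j)) i}"
  using assms(2)
proof (induction m)
  case 0
  then show ?case by simp
next
  case (Suc m)
  define r where "r = (cap_step c N q P Q ^^ m) (\<lambda>_. 0)"
  have r: "(cap_step c N q P Q ^^ Suc m) (\<lambda>_. 0) = cap_step c N q P Q r"
    by (simp add: r_def)
  have "q \<le> card {l \<in> holders c N P r (P i j). inv (Q (P i j)) l < inv (Q (P i j)) i}"
  proof (cases "j < r i")
    case False
    then have "cap_rejected c N q P Q r i \<and> j = r i"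
      using Suc.prems unfolding r by (auto simp: cap_step_apply split: if_splits)
    then show ?thesis by (simp add: cap_rejected_iff)
  qed (use Suc.IH r_def in blast)
  from better_holders_step[of q c N P r "P i j" Q, OF this] show ?case unfolding r .
qed

text \<open>Every round with a rejection raises the sum of all rejection counts, which never exceeds
  \<open>N * c\<close>.\<close>

lemma cap_terminates: "\<exists>k. \<forall>i. \<not> cap_rejected c N q P Q ((cap_step c N q P Q ^^ k) (\<lambda>_. 0)) i"
proof (rule ccontr)
  assume a: "\<not> ?thesis"
  let ?r = "\<lambda>m. (cap_step c N q P Q ^^ m) (\<lambda>_. 0)"
  have "m \<le> (\<Sum>i<N. ?r m i)" for m
  proof (induction m)
    case (Suc m)
    from a obtain i where i: "cap_rejected c N q P Q (?r m) i" by blast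
    then have "i < N" by (simp add: cap_rejected_def)
    have "(\<Sum>i<N. ?r m i) < (\<Sum>i<N. ?r (Suc m) i)"
      by (rule sum_strict_mono_ex1) (use i \<open>i < N\<close> in \<open>auto simp: cap_step_apply\<close>)
    with Suc show ?case by linarith
  qed simp
  from this[of "Suc (N * c)"] have "Suc (N * c) \<le> (\<Sum>i<N. ?r (Suc (N * c)) i)" .
  also have "\<dots> \<le> (\<Sum>i<N. c)" by (rule sum_mono) (rule cap_state_le)
  finally show False by simp
qed

lemma cap_final_eq_state: "\<exists>m. cap_final c N q P Q = (cap_step c N q P Q ^^ m) (\<lambda>_. 0)"
  unfolding cap_final_def Let_def by blast

lemma cap_final_le: "cap_final c N q P Q i \<le> c"
  using cap_final_eq_state[of c N q P Q] cap_state_le by metis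

lemma cap_final_not_rejected: "\<not> cap_rejected c N q P Q (cap_final c N q P Q) i"
  using LeastI_ex[OF cap_terminates[of c N q P Q]] unfolding cap_final_def Let_def by blast

text \<open>In an overfull school the holder of lowest priority has \<open>q\<close> others strictly
  ahead of her, strictness coming from injectivity, so the final state would still contain a
  rejection.\<close>

lemma card_holders_final_le:
  assumes inj: "\<And>i j. i < N \<Longrightarrow> j < c \<Longrightarrow> inj_on (inv (Q (P i j))) {..<N}"
  shows "card (holders c N P (cap_final c N q P Q) s) \<le> q"
proof (rule ccontr)
  let ?r = "cap_final c N q P Q"
  let ?X = "holders c N P ?r s"
  let ?f = "inv (Q s)"
  assume a: "\<not> card ?X \<le> q"
  then have "?X \<noteq> {}" by auto
  then obtain m where m: "m \<in> ?X" "\<And>y. y \<in> ?X \<Longrightarrow> ?f y \<le> ?f m"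
    using ex_max_on[OF finite_holders] by metis
  have m': "m < N" "?r m < c" "P m (?r m) = s" using m by (auto simp: holders_def)
  then have i: "inj_on ?f {..<N}" using inj by metis
  have "?X - {m} \<subseteq> {j \<in> ?X. ?f j < ?f m}"
  proof
    fix y assume y: "y \<in> ?X - {m}"
    then have "y < N" by (simp add: holders_def)
    with i y m' have "?f y \<noteq> ?f m" by (auto dest: inj_onD)
    with m(2)[of y] y show "y \<in> {j \<in> ?X. ?f j < ?f m}" by auto
  qed
  then have "card (?X - {m}) \<le> card {j \<in> ?X. ?f j < ?f m}" by (intro card_mono) auto
  moreover have "q \<le> card (?X - {m})" using m a by simp
  ultimately have "cap_rejected c N q P Q ?r m"
    unfolding cap_rejected_iff using m' by simp
  then show False using cap_final_not_rejected by blast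
qed

text \<open>The \<open>q\<close> better holders from \<open>rejecter_better_holders\<close> already
  exhaust the capacity in \<open>card_holders_final_le\<close>, so they are all the holders of the
  school.\<close>

lemma rejecter_final:
  assumes inj: "\<And>i j. i < N \<Longrightarrow> j < c \<Longrightarrow> inj_on (inv (Q (P i j))) {..<N}"
  assumes "i < N" "j < cap_final c N q P Q i"
  shows "card (holders c N P (cap_final c N q P Q) (P i j)) = q"
    and "\<And>l. l \<in> holders c N P (cap_final c N q P Q) (P i j) \<Longrightarrow>
           inv (Q (P i j)) l < inv (Q (P i j)) i"
proof -
  let ?r = "cap_final c N q P Q" and ?s = "P i j"
  let ?X = "holders c N P ?r ?s"
  let ?Y = "{l \<in> ?X. inv (Q ?s) l < inv (Q ?s) i}"
  have 1: "q \<le> card ?Y"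
  proof -
    obtain m where m: "?r = (cap_step c N q P Q ^^ m) (\<lambda>_. 0)"
      using cap_final_eq_state by blast
    show ?thesis using assms(3) unfolding m by (rule rejecter_better_holders[OF assms(2)])
  qed
  have 2: "card ?X \<le> q" by (rule card_holders_final_le) (rule inj)
  have 3: "card ?Y \<le> card ?X" by (intro card_mono) auto
  show "card ?X = q" using 1 2 3 by linarith
  have "?Y = ?X" using 1 2 3 by (intro card_subset_eq) auto
  then show "\<And>l. l \<in> ?X \<Longrightarrow> inv (Q ?s) l < inv (Q ?s) i" by auto
qed

text \<open>Longer lists only add competition. By induction over its rounds, the short run stays
  below the outcome of the long one: at a first violation a school would reject in the short run a
  student whom it keeps in the long run.\<close>

lemma cap_final_mono:
  assumes inj: "\<And>i j. i < N \<Longrightarrow> j < c' \<Longrightarrow> inj_on (inv (Q (P i j))) {..<N}"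
  assumes "c \<le> c'"
  shows "cap_final c N q P Q i \<le> cap_final c' N q P Q i"
proof -
  let ?F = "cap_final c' N q P Q"
  have "(cap_step c N q P Q ^^ m) (\<lambda>_. 0) i \<le> ?F i" for m i
  proof (induction m arbitrary: i)
    case (Suc m)
    define r where "r = (cap_step c N q P Q ^^ m) (\<lambda>_. 0)"
    have r: "(cap_step c N q P Q ^^ Suc m) (\<lambda>_. 0) = cap_step c N q P Q r"
      by (simp add: r_def)
    have IH: "r i \<le> ?F i" for i using Suc r_def by simp
    have "cap_step c N q P Q r i \<le> ?F i"
    proof (cases "cap_rejected c N q P Q r i \<and> r i = ?F i")
      case False
      then show ?thesis using IH[of i] by (auto simp: cap_step_apply)
    next
      case True
      let ?s = "P i (r i)"
      let ?Y = "{l \<in> holders c N P r ?s. inv (Q ?s) l < inv (Q ?s) i}"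
      let ?Z = "{l \<in> holders c' N P ?F ?s. inv (Q ?s) l < inv (Q ?s) i}"
      have iN: "i < N" "r i < c" and q: "q \<le> card ?Y" using True by (auto simp: cap_rejected_iff)
      have ih: "i \<in> holders c' N P ?F ?s" using iN True assms(2) by (simp add: holders_def)
      \<comment> \<open>If all better rivals of the short run still held \<open>?s\<close> at the
        end of the long run, \<open>i\<close> would be rejected there too.\<close>
      have "\<not> ?Y \<subseteq> ?Z"
      proof
        assume "?Y \<subseteq> ?Z"
        then have "card ?Y \<le> card ?Z" by (intro card_mono) auto
        then have "cap_rejected c' N q P Q ?F i"
          unfolding cap_rejected_iff using q iN True assms(2) by simp
        then show False using cap_final_not_rejected by blast
      qed
      then obtain l where l: "l \<in> ?Y" "l \<notin> ?Z" by blast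
      have lN: "l < N" "P l (r l) = ?s" "r l < c" using l by (auto simp: holders_def)
      have "r l \<noteq> ?F l" using l lN assms(2) by (auto simp: holders_def)
      \<comment> \<open>In the long run \<open>?s\<close> has rejected \<open>l\<close>, so it ranks
        its final holders, \<open>i\<close> among them, above \<open>l\<close>; but \<open>l\<close>
        was chosen ahead of \<open>i\<close>.\<close>
      then have "r l < ?F l" using IH[of l] by simp
      then have "inv (Q ?s) i < inv (Q ?s) l"
        using rejecter_final(2)[where c=c' and q=q and P=P and Q=Q, OF inj lN(1), of "r l" i] ih lN by simp
      then show ?thesis using l by simp
    qed
    then show ?case unfolding r .
  qed simp
  then show ?thesis using cap_final_eq_state[of c N q P Q] by metis
qed

section \<open>Large strongly connected components\<close>

text \<open>The witness is the class of vertices mutually reachable with a point of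
  \<open>C\<close>; every strongly connected superset of this class lies inside it.\<close>

lemma strongly_connected_subset_scc:
  assumes "strongly_connected_set V E C" "C \<noteq> {}"
  shows "\<exists>D. is_scc V E D \<and> C \<subseteq> D"
proof -
  let ?R = "(E \<inter> V \<times> V)\<^sup>*"
  obtain c where c: "c \<in> C" using assms by blast
  let ?D = "{y \<in> V. (c, y) \<in> ?R \<and> (y, c) \<in> ?R}"
  have "C \<subseteq> ?D" using assms c by (auto simp: strongly_connected_set_def)
  moreover have "strongly_connected_set V E ?D"
    unfolding strongly_connected_set_def by (auto intro: rtrancl_trans)
  moreover have "D = ?D" if "?D \<subseteq> D" "strongly_connected_set V E D" for D
  proof -
    have "c \<in> D" using c \<open>C \<subseteq> ?D\<close> that by blast
    then have "D \<subseteq> ?D" using that(2) by (auto simp: strongly_connected_set_def)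
    then show ?thesis using that by blast
  qed
  ultimately have "is_scc V E ?D" unfolding is_scc_def using c by blast
  then show ?thesis using \<open>C \<subseteq> ?D\<close> by blast
qed

text \<open>Closed sets have size below \<open>a\<close> or above \<open>card V - a\<close>. As
  \<open>3 * a\<close> is at most \<open>card V\<close>, small ones are stable under union and big
  ones under intersection. A vertex outside the largest small set \<open>S\<close> reaches a big
  set, hence all of the smallest big set \<open>C\<close>; so \<open>C - S\<close> is strongly
  connected.\<close>

lemma large_scc_if_no_balanced_closed_set:
  fixes V :: "'a set" and a :: real
  assumes "finite V" "V \<noteq> {}" "0 < a" "3 * a \<le> real (card V)"
    and bal: "\<And>A. A \<subseteq> V \<Longrightarrow> (\<And>x y. x \<in> A \<Longrightarrow> y \<in> V \<Longrightarrow> (x, y) \<in> E \<Longrightarrow> y \<in> A) \<Longrightarrow>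
       a \<le> real (card A) \<Longrightarrow> real (card A) \<le> real (card V) - a \<Longrightarrow> False"
  shows "\<exists>C. is_scc V E C \<and> real (card V) - 2 * a \<le> real (card C)"
proof -
  define closed where "closed A \<longleftrightarrow> A \<subseteq> V \<and> (\<forall>x\<in>A. \<forall>y\<in>V. (x, y) \<in> E \<longrightarrow> y \<in> A)" for A
  let ?N = "real (card V)"
  have dich: "real (card A) < a \<or> real (card A) > ?N - a" if "closed A" for A
    using bal[of A] that unfolding closed_def by force
  have fin: "finite A" if "closed A" for A using that assms(1) finite_subset closed_def by blast
  have fin_closed: "finite {A. closed A \<and> P A}" for P
    by (rule finite_subset[of _ "Pow V"]) (use assms(1) in \<open>auto simp: closed_def\<close>)
  define R where "R x = {y. (x, y) \<in> (E \<inter> V \<times> V)\<^sup>*}" for x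
  have R_refl: "x \<in> R x" for x by (simp add: R_def)
  have R_closed: "closed (R x)" if "x \<in> V" for x
  proof -
    have "y \<in> V" if "(x, y) \<in> (E \<inter> V \<times> V)\<^sup>*" for y
      using that \<open>x \<in> V\<close> by (induction rule: rtrancl_induct) auto
    then show ?thesis unfolding closed_def R_def by (auto intro: rtrancl_into_rtrancl)
  qed
  let ?small = "\<lambda>A. closed A \<and> real (card A) < a"
  have "closed {}" by (simp add: closed_def)
  then have "{A. ?small A} \<noteq> {}" using assms(3) by (metis (mono_tags) card.empty empty_iff mem_Collect_eq of_nat_0)
  then obtain S where "S \<in> {A. ?small A}" and S_max: "\<forall>A\<in>{A. ?small A}. card A \<le> card S"
    using ex_max_on[OF fin_closed, of "\<lambda>A. real (card A) < a" card] by blast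
  then have S: "?small S" "\<And>A. ?small A \<Longrightarrow> card A \<le> card S" by auto
  have small: "x \<in> S" if x: "x \<in> V" "real (card (R x)) < a" for x
  proof -
    have "closed (S \<union> R x)" using S(1) R_closed[OF x(1)] by (auto simp: closed_def)
    moreover have "real (card (S \<union> R x)) < 2 * a"
      using card_Un_le[of S "R x"] S(1) x(2) by linarith
    ultimately have "?small (S \<union> R x)" using dich[of "S \<union> R x"] assms(4) by auto
    then have "card (S \<union> R x) \<le> card S" by (rule S(2))
    then have "S \<union> R x = S" using fin[OF \<open>closed (S \<union> R x)\<close>]
      card_seteq[of "S \<union> R x" S] by simp
    then show ?thesis using R_refl by blast
  qed
  let ?big = "\<lambda>A. closed A \<and> real (card A) > ?N - a"
  have "?big V" using assms by (simp add: closed_def)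
  then obtain C where C: "?big C" "\<And>A. ?big A \<Longrightarrow> card C \<le> card A"
    using ex_has_least_nat[of ?big V card] by blast
  have big: "C \<subseteq> R x" if x: "x \<in> V - S" for x
  proof -
    have Rx: "closed (R x)" "real (card (R x)) > ?N - a"
      using x small[of x] dich[of "R x"] R_closed[of x] by auto
    have cl: "closed (C \<inter> R x)" using C(1) Rx by (auto simp: closed_def)
    have "card C + card (R x) = card (C \<union> R x) + card (C \<inter> R x)"
      using card_Un_Int[OF fin fin] C(1) Rx by blast
    moreover have "card (C \<union> R x) \<le> card V"
      using C(1) Rx by (intro card_mono assms) (auto simp: closed_def)
    ultimately have "real (card (C \<inter> R x)) > ?N - 2 * a" using C(1) Rx by linarith
    then have "?big (C \<inter> R x)" using dich[OF cl] cl assms(4) by linarith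
    then have "card C \<le> card (C \<inter> R x)" by (rule C(2))
    then have "C \<inter> R x = C" using card_seteq[of C "C \<inter> R x"] fin C(1) by simp
    then show ?thesis by blast
  qed
  have sc: "strongly_connected_set V E (C - S)"
    unfolding strongly_connected_set_def using C(1) big by (auto simp: closed_def R_def)
  have "card C \<le> card (C - S) + card S"
    using card_Un_le[of "C - S" S] card_mono[of "(C - S) \<union> S" C] fin C(1) S(1) by fastforce
  then have gt: "real (card (C - S)) > ?N - 2 * a" using C(1) S(1) by linarith
  then have "C - S \<noteq> {}" by (rule contrapos_pn) (use assms(3,4) in \<open>simp only: card.empty\<close>)
  from strongly_connected_subset_scc[OF sc this] obtain D where D: "is_scc V E D" "C - S \<subseteq> D" by blast
  have "finite D" using D(1) assms(1) finite_subset by (auto simp: is_scc_def strongly_connected_set_def)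
  then have "card (C - S) \<le> card D" using D(2) by (intro card_mono)
  then show ?thesis using D(1) gt by (intro exI[of _ D]) auto
qed

section \<open>Counting permutations and words\<close>

lemma ex_permutes_image:
  assumes "finite E" "A \<subseteq> E" "S \<subseteq> E" "card A = card S"
  shows "\<exists>\<tau>. \<tau> permutes E \<and> \<tau> ` A = S"
proof -
  have fin: "finite A" "finite S" using assms finite_subset by blast+
  obtain f where f: "bij_betw f A S" using assms(4) fin finite_same_card_bij by blast
  have "card (E - A) = card (E - S)" using assms fin by (simp add: card_Diff_subset)
  then obtain g where g: "bij_betw g (E - A) (E - S)"
    using assms(1) finite_same_card_bij[of "E - A" "E - S"] by blast
  let ?t = "\<lambda>x. if x \<in> A then f x else if x \<in> E then g x else x"
  have "bij_betw ?t (A \<union> (E - A)) (S \<union> (E - S))"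
  proof (rule bij_betw_combine)
    show "bij_betw ?t A S" using f by (simp cong: bij_betw_cong)
    show "bij_betw ?t (E - A) (E - S)" using g assms(2) by (subst bij_betw_cong[of _ _ g]) auto
  qed auto
  then have "bij_betw ?t E E" using assms by (simp add: Un_absorb1)
  then have "?t permutes E" using assms by (intro bij_imp_permutes) auto
  moreover have "?t ` A = S" using f by (auto simp: bij_betw_def)
  ultimately show ?thesis by blast
qed

text \<open>Composing with the transposition of \<open>l\<close> and \<open>m\<close> moves the
  value at position \<open>l\<close> to position \<open>m\<close> and keeps the prefix below
  \<open>l\<close>. This value is prescribed, so \<open>m\<close> and then \<open>p\<close> can be
  recovered.\<close>

lemma card_permutations_prefix_step:
  assumes "l < n"
  shows "card {p. p permutes {..<n} \<and> (\<forall>j<Suc l. p j = w j)} * (n - l)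
           \<le> card {p. p permutes {..<n} \<and> (\<forall>j<l. p j = w j)}"
proof -
  let ?S = "\<lambda>l. {p. p permutes {..<n} \<and> (\<forall>j<l. p j = w j)}"
  have fin: "finite (?S l)" for l
    by (rule finite_subset[OF _ finite_permutations[of "{..<n}"]]) auto
  have "card (?S (Suc l)) * (n - l) = card (?S (Suc l) \<times> {l..<n})"
    by (simp only: card_cartesian_product card_atLeastLessThan)
  also have "\<dots> \<le> card (?S l)"
  proof (rule card_inj_on_le[where f = "\<lambda>(p, m). p \<circ> Transposition.transpose l m"])
    show "inj_on (\<lambda>(p, m). p \<circ> Transposition.transpose l m) (?S (Suc l) \<times> {l..<n})"
    proof (rule inj_onI, clarify)
      fix p m p' m'
      assume p: "p permutes {..<n}" "\<forall>j<Suc l. p j = w j"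
        and p': "p' permutes {..<n}" "\<forall>j<Suc l. p' j = w j"
        and eq: "p \<circ> Transposition.transpose l m = p' \<circ> Transposition.transpose l m'"
      have "(p' \<circ> Transposition.transpose l m') m = p l" using eq[symmetric] by simp
      also have "p l = p' l" using p p' by simp
      finally have "Transposition.transpose l m' m = l"
        using permutes_inj[OF p'(1)] by (auto dest: injD)
      then have mm: "m = m'" by (metis transpose_eq_iff transpose_apply_second transpose_involutory)
      have "p \<circ> Transposition.transpose l m \<circ> Transposition.transpose l m = p' \<circ> Transposition.transpose l m \<circ> Transposition.transpose l m"
        using eq mm by simp
      then have "p = p'" by (simp add: o_assoc[symmetric])
      with mm show "p = p' \<and> m = m'" by simp
    qed
    show "(\<lambda>(p, m). p \<circ> Transposition.transpose l m) ` (?S (Suc l) \<times> {l..<n}) \<subseteq> ?S l"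
    proof clarify
      fix p m assume p: "p permutes {..<n}" "\<forall>j<Suc l. p j = w j" and m: "m \<in> {l..<n}"
      have "p \<circ> Transposition.transpose l m permutes {..<n}"
        using p m assms by (intro permutes_compose permutes_swap_id) auto
      moreover have "(p \<circ> Transposition.transpose l m) j = w j" if "j < l" for j
        using that m p by (simp add: transpose_apply_other)
      ultimately show "p \<circ> Transposition.transpose l m permutes {..<n} \<and>
          (\<forall>j<l. (p \<circ> Transposition.transpose l m) j = w j)" by blast
    qed
    show "finite (?S l)" by (rule fin)
  qed
  finally show ?thesis .
qed

text \<open>The factors \<open>n - j\<close> of the single steps are all lowered to
  \<open>n - K\<close>, so that prefixes of every length up to \<open>K\<close> obey the bound for
  independent draws from \<open>n - K\<close> values.\<close>

lemma card_permutations_prefix: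
  assumes "l \<le> K" "K \<le> n"
  shows "card {p. p permutes {..<n} \<and> (\<forall>j<l. p j = w j)} * (n - K) ^ l \<le> fact n"
  using assms(1)
proof (induction l)
  case 0
  then show ?case by (simp add: card_permutations)
next
  case (Suc l)
  let ?S = "\<lambda>l. {p. p permutes {..<n} \<and> (\<forall>j<l. p j = w j)}"
  have "card (?S (Suc l)) * (n - K) ^ Suc l = (card (?S (Suc l)) * (n - K)) * (n - K) ^ l" by simp
  also have "\<dots> \<le> (card (?S (Suc l)) * (n - l)) * (n - K) ^ l"
    using Suc.prems by (intro mult_mono) auto
  also have "\<dots> \<le> card (?S l) * (n - K) ^ l"
    using Suc.prems assms(2) by (intro mult_right_mono card_permutations_prefix_step) auto
  also have "\<dots> \<le> fact n" using Suc by simp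
  finally show ?case .
qed

text \<open>\<open>inv \<sigma> a\<close> is the position of \<open>a\<close>. Relabelling by
  \<open>T S\<close>, which carries \<open>A\<close> to \<open>S\<close> and \<open>B\<close> to the
  rest of \<open>A \<union> B\<close>, gives an order in which \<open>S\<close> precedes that rest.
  Distinct pairs \<open>(\<sigma>, S)\<close> give distinct orders, whence the binomial
  factor.\<close>

lemma card_permutations_separating:
  assumes "finite U" "A \<subseteq> U" "B \<subseteq> U" "A \<inter> B = {}"
  shows "card {\<sigma>. \<sigma> permutes U \<and> (\<forall>a\<in>A. \<forall>b\<in>B. inv \<sigma> a < (inv \<sigma> b :: nat))}
           * ((card A + card B) choose card A) \<le> fact (card U)"
proof -
  let ?E = "A \<union> B"
  let ?G = "{\<sigma>. \<sigma> permutes U \<and> (\<forall>a\<in>A. \<forall>b\<in>B. inv \<sigma> a < inv \<sigma> b)}"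
  let ?C = "{S. S \<subseteq> ?E \<and> card S = card A}"
  have finE: "finite ?E" "finite A" "finite B" using assms by (auto intro: finite_subset)
  have "\<forall>S\<in>?C. \<exists>\<tau>. \<tau> permutes ?E \<and> \<tau> ` A = S"
    using ex_permutes_image[OF finE(1)] by force
  from bchoice[OF this] obtain T where T': "\<forall>S\<in>?C. T S permutes ?E \<and> T S ` A = S" by blast
  have T: "T S permutes ?E" "T S ` A = S" if "S \<in> ?C" for S using T' that by blast+
  have TB: "T S ` B = ?E - S" if "S \<in> ?C" for S
  proof -
    have "T S ` ?E = ?E" using T(1)[OF that] by (rule permutes_image)
    moreover have "T S ` A \<inter> T S ` B = {}"
      using permutes_inj[OF T(1)[OF that]] assms(4) by (auto dest: injD)
    ultimately show ?thesis using T(2)[OF that] unfolding image_Un by blast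
  qed
  have TU: "T S permutes U" if "S \<in> ?C" for S
    by (rule permutes_subset[OF T(1)[OF that]]) (use assms in auto)
  have sep: "inv (T S \<circ> \<sigma>) x < inv (T S \<circ> \<sigma>) y"
    if h: "S \<in> ?C" "\<sigma> \<in> ?G" "x \<in> S" "y \<in> ?E - S" for S \<sigma> x y
  proof -
    have "x \<in> T S ` A" by (subst T(2)[OF h(1)]) (rule h(3))
    then obtain a where a: "a \<in> A" "x = T S a" by (rule imageE)
    have "y \<in> T S ` B" by (subst TB[OF h(1)]) (rule h(4))
    then obtain b where b: "b \<in> B" "y = T S b" by (rule imageE)
    have bs: "bij (T S)" "bij \<sigma>" using TU[OF h(1)] h(2) permutes_bij by auto
    have "inv (T S \<circ> \<sigma>) (T S z) = inv \<sigma> z" for z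
      using bs by (simp add: o_inv_distrib bij_is_inj inv_f_f)
    then show ?thesis using a b h by auto
  qed
  have "card (?G) * card ?C = card (?G \<times> ?C)" by (simp add: card_cartesian_product)
  also have "\<dots> \<le> card {\<sigma>. \<sigma> permutes U}"
  proof (rule card_inj_on_le[where f = "\<lambda>(\<sigma>, S). T S \<circ> \<sigma>"])
    show "inj_on (\<lambda>(\<sigma>, S). T S \<circ> \<sigma>) (?G \<times> ?C)"
    proof (rule inj_onI)
      fix u v assume u: "u \<in> ?G \<times> ?C" and v: "v \<in> ?G \<times> ?C"
        and eq: "(\<lambda>(\<sigma>, S). T S \<circ> \<sigma>) u = (\<lambda>(\<sigma>, S). T S \<circ> \<sigma>) v"
      obtain \<sigma> S where u': "u = (\<sigma>, S)" by force
      obtain \<sigma>' S' where v': "v = (\<sigma>', S')" by force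
      have m: "\<sigma> \<in> ?G" "S \<in> ?C" "\<sigma>' \<in> ?G" "S' \<in> ?C" using u v u' v' by auto
      have e: "T S \<circ> \<sigma> = T S' \<circ> \<sigma>'" using eq u' v' by simp
      have finS: "finite S" "finite S'" using m finE finite_subset by blast+
      have "S = S'"
      proof (rule ccontr)
        assume "S \<noteq> S'"
        moreover have "card S = card S'" using m by simp
        ultimately have "\<not> S \<subseteq> S'" "\<not> S' \<subseteq> S" using finS by (metis card_subset_eq)+
        \<comment> \<open>The common order would have to place \<open>x\<close> and \<open>y\<close>
          each before the other.\<close>
        then obtain x y where xy: "x \<in> S" "x \<notin> S'" "y \<in> S'" "y \<notin> S" by blast
        have "x \<in> ?E" "y \<in> ?E" using xy m by blast+
        then show False
          using sep[OF m(2,1), of x y] sep[OF m(4,3), of y x] xy e by simp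
      qed
      moreover have "\<sigma> = \<sigma>'"
      proof -
        have "inj (T S)" using TU[OF m(2)] by (rule permutes_inj)
        then show ?thesis using e \<open>S = S'\<close> by (metis fun.inj_map injD)
      qed
      ultimately show "u = v" using u' v' by simp
    qed
    show "(\<lambda>(\<sigma>, S). T S \<circ> \<sigma>) ` (?G \<times> ?C) \<subseteq> {\<sigma>. \<sigma> permutes U}"
      using permutes_compose[OF _ TU] by auto
    show "finite {\<sigma>. \<sigma> permutes U}" using assms by (simp add: finite_permutations)
  qed
  also have "\<dots> = fact (card U)" using assms by (simp add: card_permutations)
  also have "card ?C = (card A + card B) choose card A"
    using n_subsets[OF finE(1), of "card A"] finE assms(4) by (simp add: card_Un_disjoint)
  finally show ?thesis .
qed

section \<open>Words of applications, quotas and exchangeability\<close>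

definition fibre :: "'a set \<Rightarrow> ('a \<Rightarrow> nat) \<Rightarrow> nat \<Rightarrow> 'a set" where
  "fibre D x s = {d \<in> D. x d = s}"

text \<open>\<open>D\<close> is the set of applications, \<open>x\<close> names the school receiving
  each of them, and \<open>B\<close> is the set of accepted ones.\<close>

definition quota_words :: "nat \<Rightarrow> nat \<Rightarrow> 'a set \<Rightarrow> 'a set \<Rightarrow> ('a \<Rightarrow> nat) set" where
  "quota_words n q D B = {x \<in> D \<rightarrow>\<^sub>E {..<n}.
      \<forall>s<n. card (B \<inter> fibre D x s) = min q (card (fibre D x s))}"

text \<open>The probability that uniformly random priorities make each school accept one prescribed
  set, of the right size, of its applicants.\<close>

definition quota_weight :: "nat \<Rightarrow> nat \<Rightarrow> 'a set \<Rightarrow> ('a \<Rightarrow> nat) \<Rightarrow> real" where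
  "quota_weight n q D x =
     (\<Prod>s<n. 1 / real (card (fibre D x s) choose min q (card (fibre D x s))))"

lemma quota_weight_nonneg: "0 \<le> quota_weight n q D x"
  unfolding quota_weight_def by (intro prod_nonneg) auto

text \<open>For a fixed word \<open>x\<close>, the weight makes the set of accepted positions uniform among those
  meeting the quotas exactly. Permuting positions preserves the set of all words, so the total weight
  of a set \<open>B\<close> of accepted positions depends on \<open>card B\<close> only.\<close>

lemma quota_weight_sum_permute:
  assumes \<tau>: "\<tau> permutes D"
  shows "(\<Sum>x\<in>quota_words n q D B. quota_weight n q D x)
       = (\<Sum>x\<in>quota_words n q D (\<tau> ` B). quota_weight n q D x)"
proof (rule sum.reindex_bij_witness[where j = "\<lambda>x. x \<circ> inv \<tau>" and i = "\<lambda>x. x \<circ> \<tau>"])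
  have fib: "fibre D (x \<circ> \<pi>) s = inv \<pi> ` fibre D x s" if "\<pi> permutes D" for x s and \<pi> :: "'a \<Rightarrow> 'a"
  proof -
    have "d \<in> inv \<pi> ` fibre D x s" if "d \<in> D" "x (\<pi> d) = s" for d
      using that \<open>\<pi> permutes D\<close> by (intro image_eqI[of _ _ "\<pi> d"])
        (auto simp: fibre_def permutes_inverses permutes_in_image)
    moreover have "inv \<pi> d \<in> D" "\<pi> (inv \<pi> d) = d" if "d \<in> D" for d
      using that \<open>\<pi> permutes D\<close> by (auto simp: permutes_inverses permutes_in_image[OF permutes_inv])
    ultimately show ?thesis by (auto simp: fibre_def)
  qed
  have cardfib: "card (fibre D (x \<circ> \<pi>) s) = card (fibre D x s)" if "\<pi> permutes D" for x s and \<pi> :: "'a \<Rightarrow> 'a"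
    using that permutes_inj_on[OF permutes_inv[OF that]] by (simp add: fib card_image)
  have w: "quota_weight n q D (x \<circ> \<pi>) = quota_weight n q D x" if "\<pi> permutes D" for x and \<pi> :: "'a \<Rightarrow> 'a"
    using that by (simp add: quota_weight_def cardfib)
  have mem: "x \<circ> \<pi> \<in> quota_words n q D (inv \<pi> ` C)"
    if "\<pi> permutes D" "x \<in> quota_words n q D C" for x C and \<pi> :: "'a \<Rightarrow> 'a"
  proof -
    have "x \<circ> \<pi> \<in> D \<rightarrow>\<^sub>E {..<n}"
      using that permutes_in_image[OF that(1)] permutes_not_in[OF that(1)]
      by (auto simp: quota_words_def PiE_iff extensional_def)
    moreover have "card (inv \<pi> ` C \<inter> inv \<pi> ` fibre D x s) = card (C \<inter> fibre D x s)" for s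
      using permutes_inj_on[OF permutes_inv[OF that(1)]] permutes_inj[OF permutes_inv[OF that(1)]]
      by (simp add: image_Int[symmetric] card_image)
    ultimately show ?thesis
      using that(2) cardfib[OF that(1)] by (simp add: quota_words_def fib[OF that(1)]) 
  qed
  note iv = permutes_inv[OF \<tau>] permutes_inv_inv[OF \<tau>]
  show "x \<circ> inv \<tau> \<in> quota_words n q D (\<tau> ` B)" if "x \<in> quota_words n q D B" for x
    using mem[OF iv(1) that] iv by simp
  show "x \<circ> \<tau> \<in> quota_words n q D B" if "x \<in> quota_words n q D (\<tau> ` B)" for x
    using mem[OF \<tau> that] permutes_inj[OF \<tau>] by (simp add: image_image inv_f_f)
  show "x \<circ> inv \<tau> \<circ> \<tau> = x" "x \<circ> \<tau> \<circ> inv \<tau> = x" for x :: "'a \<Rightarrow> nat"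
    using permutes_inv_o[OF \<tau>] by (simp_all add: o_assoc[symmetric])
  show "quota_weight n q D (x \<circ> inv \<tau>) = quota_weight n q D x" for x
    by (rule w) (rule iv)
qed

text \<open>A set \<open>B\<close> is determined by its traces on the fibres, and the number of
  families of traces of the required sizes is the inverse of the weight.\<close>

lemma card_quota_sets_le:
  assumes "finite D" "x \<in> D \<rightarrow>\<^sub>E {..<n}"
  shows "real (card {B. B \<subseteq> D \<and> x \<in> quota_words n q D B}) * quota_weight n q D x \<le> 1"
proof -
  let ?c = "\<lambda>s. card (fibre D x s)"
  let ?F = "PiE {..<n} (\<lambda>s. {C. C \<subseteq> fibre D x s \<and> card C = min q (?c s)})"
  have finf: "finite (fibre D x s)" for s using assms by (simp add: fibre_def)
  have "card {B. B \<subseteq> D \<and> x \<in> quota_words n q D B} \<le> card ?F"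
  proof (rule card_inj_on_le[where f = "\<lambda>B. \<lambda>s\<in>{..<n}. B \<inter> fibre D x s"])
    show "inj_on (\<lambda>B. \<lambda>s\<in>{..<n}. B \<inter> fibre D x s) {B. B \<subseteq> D \<and> x \<in> quota_words n q D B}"
    proof (rule inj_onI)
      fix B B' assume b: "B \<in> {B. B \<subseteq> D \<and> x \<in> quota_words n q D B}"
        "B' \<in> {B. B \<subseteq> D \<and> x \<in> quota_words n q D B}"
        and eq: "(\<lambda>s\<in>{..<n}. B \<inter> fibre D x s) = (\<lambda>s\<in>{..<n}. B' \<inter> fibre D x s)"
      have "B \<inter> fibre D x s = B' \<inter> fibre D x s" if "s < n" for s
        using fun_cong[OF eq, of s] that by simp
      then have "d \<in> B \<longleftrightarrow> d \<in> B'" if "d \<in> D" for d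
        using assms(2) that by (auto simp: fibre_def PiE_iff)
      then show "B = B'" using b by blast
    qed
    show "(\<lambda>B. \<lambda>s\<in>{..<n}. B \<inter> fibre D x s) ` {B. B \<subseteq> D \<and> x \<in> quota_words n q D B} \<subseteq> ?F"
      by (auto simp: quota_words_def)
    show "finite ?F" by (intro finite_PiE) (auto simp: finf)
  qed
  also have "card ?F = (\<Prod>s<n. ?c s choose min q (?c s))"
    by (simp add: card_PiE n_subsets finf)
  finally have le: "real (card {B. B \<subseteq> D \<and> x \<in> quota_words n q D B})
      \<le> (\<Prod>s<n. real (?c s choose min q (?c s)))"
    by (simp only: of_nat_prod[symmetric] of_nat_le_iff)
  have w: "quota_weight n q D x = 1 / (\<Prod>s<n. real (?c s choose min q (?c s)))"
    unfolding quota_weight_def by (simp add: prod_dividef)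
  have pos: "(\<Prod>s<n. real (?c s choose min q (?c s))) > 0" by (intro prod_pos) auto
  show ?thesis unfolding w using le pos by simp
qed

text \<open>By \<open>quota_weight_sum_permute\<close> all sets of the size of \<open>B\<close> have
  the same sum, so the left side is a sum over all of them. After exchanging summations a word
  contributes at most 1 by \<open>card_quota_sets_le\<close>, and nothing unless it forces exactly
  \<open>card B\<close> acceptances.\<close>

lemma quota_weight_sum_le:
  assumes "finite D" "B \<subseteq> D"
  shows "(\<Sum>x\<in>quota_words n q D B. quota_weight n q D x) * real (card D choose card B)
       \<le> real (card {x \<in> D \<rightarrow>\<^sub>E {..<n}. (\<Sum>s<n. min q (card (fibre D x s))) = card B})"
proof -
  let ?C = "{C. C \<subseteq> D \<and> card C = card B}"
  let ?W = "D \<rightarrow>\<^sub>E {..<n}"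
  let ?w = "quota_weight n q D"
  have fin: "finite ?C" "finite ?W" using assms by (auto intro: finite_PiE)
  have eq: "(\<Sum>x\<in>quota_words n q D C. ?w x) = (\<Sum>x\<in>quota_words n q D B. ?w x)" if "C \<in> ?C" for C
    using ex_permutes_image[OF assms(1,2), of C] that quota_weight_sum_permute by fastforce
  have sub: "card B = (\<Sum>s<n. min q (card (fibre D x s)))"
    if x: "x \<in> quota_words n q D C" and C: "C \<in> ?C" for x C
  proof -
    have "C = (\<Union>s<n. C \<inter> fibre D x s)" using x C by (auto simp: quota_words_def fibre_def PiE_iff)
    then have "card C = card (\<Union>s<n. C \<inter> fibre D x s)" by simp
    also have "\<dots> = (\<Sum>s<n. card (C \<inter> fibre D x s))"
      using assms by (intro card_UN_disjoint) (auto simp: fibre_def)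
    also have "\<dots> = (\<Sum>s<n. min q (card (fibre D x s)))" using x by (auto simp: quota_words_def)
    finally show ?thesis using C by simp
  qed
  have "(\<Sum>x\<in>quota_words n q D B. ?w x) * real (card D choose card B)
      = (\<Sum>C\<in>?C. \<Sum>x\<in>quota_words n q D C. ?w x)"
    using eq n_subsets[OF assms(1), of "card B"] by simp
  also have "\<dots> = (\<Sum>C\<in>?C. \<Sum>x\<in>?W. if x \<in> quota_words n q D C then ?w x else 0)"
    by (intro sum.cong refl sum.mono_neutral_cong_left) (use fin in \<open>auto simp: quota_words_def\<close>)
  also have "\<dots> = (\<Sum>x\<in>?W. \<Sum>C\<in>?C. if x \<in> quota_words n q D C then ?w x else 0)"
    by (rule sum.swap)
  also have "\<dots> \<le> (\<Sum>x\<in>?W. if (\<Sum>s<n. min q (card (fibre D x s))) = card B then 1 else 0)"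
  proof (rule sum_mono)
    fix x assume x: "x \<in> ?W"
    show "(\<Sum>C\<in>?C. if x \<in> quota_words n q D C then ?w x else 0)
       \<le> (if (\<Sum>s<n. min q (card (fibre D x s))) = card B then 1 else 0)"
    proof (cases "(\<Sum>s<n. min q (card (fibre D x s))) = card B")
      case True
      have "(\<Sum>C\<in>?C. if x \<in> quota_words n q D C then ?w x else 0)
          = real (card (?C \<inter> {C. x \<in> quota_words n q D C})) * ?w x"
        using fin by (simp add: sum.If_cases)
      also have "\<dots> \<le> real (card {B. B \<subseteq> D \<and> x \<in> quota_words n q D B}) * ?w x"
        using assms by (intro mult_right_mono of_nat_mono card_mono) (auto simp: quota_weight_nonneg)
      also have "\<dots> \<le> 1" by (rule card_quota_sets_le) (use assms x in auto)
      finally show ?thesis using True by simp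
    next
      case False
      then show ?thesis using sub by (intro order.trans[OF sum_nonpos]) auto
    qed
  qed
  also have "\<dots> = real (card {x \<in> ?W. (\<Sum>s<n. min q (card (fibre D x s))) = card B})"
    using fin by (simp add: sum.If_cases Int_def)
  finally show ?thesis .
qed

section \<open>Inverse binomial coefficients bounded by the mode of a binomial law\<close>

text \<open>The factors of the larger factorial lying between \<open>j\<close> and \<open>a\<close>
  are compared with \<open>a\<close>. Equivalently, the Poisson weight \<open>a ^ j / fact j\<close>
  is largest at \<open>j = a\<close>.\<close>

lemma fact_mult_power_le: "fact a * a ^ j \<le> fact j * (a::nat) ^ a"
proof (cases "j \<le> a")
  case True
  have "fact a = (fact j * \<Prod>{Suc j..a} :: nat)"
    using fact_eq_fact_times[OF True] by (metis mult.commute)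
  moreover have "\<Prod>{Suc j..a} \<le> (\<Prod>i\<in>{Suc j..a}. a)" by (rule prod_mono) auto
  ultimately have "fact a * a ^ j \<le> fact j * a ^ (a - j) * a ^ j" by simp
  also have "\<dots> = fact j * a ^ a" using True by (simp add: power_add[symmetric])
  finally show ?thesis .
next
  case False
  then have le: "a \<le> j" by simp
  have "(\<Prod>i\<in>{Suc a..j}. a) \<le> \<Prod>{Suc a..j}" by (rule prod_mono) auto
  then have "a ^ (j - a) \<le> \<Prod>{Suc a..j}" by simp
  then have "fact a * a ^ a * a ^ (j - a) \<le> fact a * a ^ a * \<Prod>{Suc a..j}" by (rule mult_left_mono) simp
  moreover have "fact j = (fact a * \<Prod>{Suc a..j} :: nat)"
    using fact_eq_fact_times[OF le] by (metis mult.commute)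
  moreover have "a ^ j = a ^ a * a ^ (j - a)" using le by (simp add: power_add[symmetric])
  ultimately show ?thesis by (simp add: mult_ac)
qed

text \<open>Written with factorials the term splits into two Poisson weights, and
  \<open>j = a\<close> maximises both at once.\<close>

lemma binomial_term_le_mode:
  assumes "j \<le> a + b"
  shows "real (a + b choose j) * real a ^ j * real b ^ (a + b - j)
       \<le> real (a + b choose a) * real a ^ a * real b ^ b"
proof -
  have eq: "real (a + b choose i) = fact (a + b) / (fact i * fact (a + b - i))" if "i \<le> a + b" for i
    using that by (rule binomial_fact)
  have 1: "real a ^ j / fact j \<le> real a ^ a / fact a"
    using fact_mult_power_le[of a j, folded of_nat_le_iff[where 'a=real]]
    by (simp add: field_simps)
  have 2: "real b ^ (a + b - j) / fact (a + b - j) \<le> real b ^ b / fact b"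
    using fact_mult_power_le[of b "a + b - j", folded of_nat_le_iff[where 'a=real]]
    by (simp add: field_simps)
  have "real (a + b choose j) * real a ^ j * real b ^ (a + b - j)
      = fact (a + b) * ((real a ^ j / fact j) * (real b ^ (a + b - j) / fact (a + b - j)))"
    using assms by (simp add: eq)
  also have "\<dots> \<le> fact (a + b) * ((real a ^ a / fact a) * (real b ^ b / fact b))"
    by (intro mult_left_mono mult_mono 1 2) auto
  also have "\<dots> = real (a + b choose a) * real a ^ a * real b ^ b" by (simp add: eq)
  finally show ?thesis .
qed

text \<open>Expanding \<open>(a + b) ^ (a + b)\<close> gives \<open>a + b + 1\<close> terms, none
  above the one at the mode. The factor \<open>p ^ a * (1 - p) ^ b\<close> is the probability of
  \<open>a\<close> successes and \<open>b\<close> failures in a fixed order, which brings in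
  independent trials.\<close>

lemma inverse_binomial_le:
  assumes "0 < a + b" and p: "p = real a / real (a + b)"
  shows "1 / real (a + b choose a) \<le> real (a + b + 1) * (p ^ a * (1 - p) ^ b)"
proof -
  let ?M = "a + b"
  have "real ?M ^ ?M = (\<Sum>j\<le>?M. real (?M choose j) * real a ^ j * real b ^ (?M - j))"
    by (simp add: binomial_ring)
  also have "\<dots> \<le> (\<Sum>j\<le>?M. real (?M choose a) * real a ^ a * real b ^ b)"
    by (intro sum_mono binomial_term_le_mode) simp
  also have "\<dots> = real (?M + 1) * real (?M choose a) * (real a ^ a * real b ^ b)" by simp
  finally have *: "real ?M ^ ?M \<le> real (?M + 1) * real (?M choose a) * (real a ^ a * real b ^ b)" .
  have q: "1 - p = real b / real ?M" 
  proof -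
    have "real a + real b > 0" using assms by linarith
    then show ?thesis by (simp add: p field_simps)
  qed
  have pp: "p ^ a * (1 - p) ^ b = (real a ^ a * real b ^ b) / real ?M ^ ?M"
    unfolding q unfolding p by (simp add: power_divide power_add)
  have M: "real ?M ^ ?M > 0" using assms(1) by (intro zero_less_power) (simp only: of_nat_0_less_iff)
  have c: "real (?M choose a) > 0" by simp
  have "1 \<le> real (?M + 1) * real (?M choose a) * (real a ^ a * real b ^ b) / real ?M ^ ?M"
    using * M by (simp only: le_divide_eq_1_pos)
  also have "\<dots> = real (?M choose a) * (real (?M + 1) * (p ^ a * (1 - p) ^ b))"
    unfolding pp by simp
  finally show ?thesis using c by (simp add: divide_le_eq mult.commute)
qed

section \<open>Balls in bins with few empty bins\<close>

text \<open>Negative correlation: the bound is what independent bins would give. Induction on the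
  balls: once \<open>d\<close> falls into bin \<open>s\<close>, the others have to cover
  \<open>Y - {s}\<close>.\<close>

lemma card_covering_words_le:
  assumes "finite D" "0 < n" "Y \<subseteq> {..<n}"
  shows "real (card {x \<in> D \<rightarrow>\<^sub>E {..<n}. Y \<subseteq> x ` D})
       \<le> real n ^ card D * (1 - (1 - 1 / real n) ^ card D) ^ card Y"
  using assms
proof (induction D arbitrary: Y rule: finite_induct)
  case empty
  show ?case
  proof (cases "Y = {}")
    case False
    then have "{x \<in> {} \<rightarrow>\<^sub>E {..<n}. Y \<subseteq> x ` {}} = {}" by auto
    then show ?thesis by simp
  qed simp
next
  case (insert d D)
  let ?C = "\<lambda>D Y. {x \<in> D \<rightarrow>\<^sub>E {..<n}. Y \<subseteq> x ` D}"
  let ?M = "card D" and ?m = "card Y"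
  define a where "a = 1 - (1 - 1 / real n) ^ ?M"
  have finY: "finite Y" using insert.prems(2) finite_subset by blast
  have pow: "(1 - 1 / real n) ^ ?M \<le> 1" using insert.prems(1) by (intro power_le_one) auto
  have pow0: "(1 - 1 / real n) ^ ?M \<ge> 0" using insert.prems(1) by (intro zero_le_power) auto
  have a: "0 \<le> a" "a \<le> 1" using pow pow0 by (auto simp: a_def)
  have a': "1 - (1 - 1 / real n) ^ card (insert d D) = a + (1 - a) / real n"
    using insert.hyps insert.prems(1) by (simp add: a_def field_simps)
  have fin: "finite (?C D Z)" for Z
    using insert.hyps(1) by (auto intro: finite_subset[OF _ finite_PiE[of D "\<lambda>_. {..<n}"]])
  have "card (?C (insert d D) Y) \<le> card (SIGMA s:{..<n}. ?C D (Y - {s}))"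
  proof (rule card_inj_on_le[where f = "\<lambda>x. (x d, restrict x D)"])
    show "inj_on (\<lambda>x. (x d, restrict x D)) (?C (insert d D) Y)"
    proof (rule inj_onI, clarify)
      fix x y assume x: "x \<in> insert d D \<rightarrow>\<^sub>E {..<n}" and y: "y \<in> insert d D \<rightarrow>\<^sub>E {..<n}"
        and e: "x d = y d" "restrict x D = restrict y D"
      have "x z = y z" if "z \<in> D" for z using fun_cong[OF e(2), of z] that by simp
      then show "x = y" using x y e(1) by (intro PiE_ext[of x _ _ y]) auto
    qed
    show "(\<lambda>x. (x d, restrict x D)) ` ?C (insert d D) Y \<subseteq> (SIGMA s:{..<n}. ?C D (Y - {s}))"
      by (auto simp: PiE_iff)
    show "finite (SIGMA s:{..<n}. ?C D (Y - {s}))" using fin by blast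
  qed
  also have "\<dots> = (\<Sum>s<n. card (?C D (Y - {s})))" using fin by simp
  finally have "real (card (?C (insert d D) Y)) \<le> (\<Sum>s<n. real (card (?C D (Y - {s}))))"
    by (simp only: of_nat_sum[symmetric] of_nat_le_iff)
  also have "\<dots> \<le> (\<Sum>s<n. real n ^ ?M * a ^ card (Y - {s}))"
    unfolding a_def using insert.prems by (intro sum_mono insert.IH) auto
  also have "\<dots> = real n ^ ?M * (\<Sum>s<n. a ^ card (Y - {s}))" by (simp add: sum_distrib_left)
  also have "(\<Sum>s<n. a ^ card (Y - {s})) = (\<Sum>s\<in>Y. a ^ (?m - 1)) + (\<Sum>s\<in>{..<n} - Y. a ^ ?m)"
  proof -
    have "(\<Sum>s<n. a ^ card (Y - {s}))
        = (\<Sum>s\<in>{..<n} - Y. a ^ card (Y - {s})) + (\<Sum>s\<in>Y. a ^ card (Y - {s}))"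
      using insert.prems by (intro sum.subset_diff) auto
    also have "(\<Sum>s\<in>Y. a ^ card (Y - {s})) = (\<Sum>s\<in>Y. a ^ (?m - 1))"
      by (intro sum.cong refl) (simp add: finY)
    also have "(\<Sum>s\<in>{..<n} - Y. a ^ card (Y - {s})) = (\<Sum>s\<in>{..<n} - Y. a ^ ?m)"
      by (intro sum.cong refl) simp
    finally show ?thesis by simp
  qed
  also have "\<dots> = real ?m * a ^ (?m - 1) + (real n - real ?m) * a ^ ?m"
    using insert.prems finY card_mono[of "{..<n}" Y] by (simp add: card_Diff_subset of_nat_diff)
  \<comment> \<open>The left side equals \<open>n * a ^ ?m + ?m * a ^ (?m - 1) * (1 - a)\<close>,
    the first two terms in the expansion of the right side. Bernoulli's inequality is used after
    factoring out \<open>a ^ ?m\<close>, so \<open>a = 0\<close> is treated apart.\<close>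
  also have "\<dots> \<le> real n * (a + (1 - a) / real n) ^ ?m"
  proof (cases "?m")
    case (Suc k)
    show ?thesis
    proof (cases "a = 0")
      case True
      then show ?thesis
      proof (cases k)
        case 0
        then show ?thesis using Suc True insert.prems(1) by simp
      next
        case (Suc k')
        then show ?thesis using \<open>?m = Suc k\<close> True by simp
      qed
    next
      case False
      then have a0: "a > 0" using a by simp
      let ?h = "(1 - a) / (real n * a)"
      have "1 + real ?m * ?h \<le> (1 + ?h) ^ ?m"
        using a a0 by (intro Bernoulli_inequality) (auto intro: order.trans[of _ 0])
      then have "real n * a ^ ?m * (1 + real ?m * ?h) \<le> real n * a ^ ?m * (1 + ?h) ^ ?m"
        using a by (intro mult_left_mono) auto
      also have "\<dots> = real n * (a * (1 + ?h)) ^ ?m" by (simp add: power_mult_distrib)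
      also have "a * (1 + ?h) = a + (1 - a) / real n"
        using a0 insert.prems(1) by (simp add: field_simps)
      finally have "real n * a ^ ?m * (1 + real ?m * ?h) \<le> real n * (a + (1 - a) / real n) ^ ?m" .
      moreover have "real n * a ^ ?m * (1 + real ?m * ?h)
          = real n * a ^ ?m + real ?m * (a ^ (?m - 1) * (real n * a * ?h))"
        using Suc by (simp add: algebra_simps)
      moreover have "real n * a * ?h = 1 - a" using a0 insert.prems(1) by simp
      ultimately have "real n * a ^ ?m + real ?m * (a ^ (?m - 1) * (1 - a))
          \<le> real n * (a + (1 - a) / real n) ^ ?m" by metis
      moreover have "a ^ ?m = a * a ^ (?m - 1)" using Suc by simp
      ultimately show ?thesis by (simp add: algebra_simps)
    qed
  qed simp
  also have "real n ^ ?M * (real n * (a + (1 - a) / real n) ^ ?m)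
    = real n ^ card (insert d D) * (1 - (1 - 1 / real n) ^ card (insert d D)) ^ ?m"
    unfolding a' using insert.hyps by simp
  finally show ?case using insert.prems(1) by (simp add: mult_left_mono)
qed

lemma sum_Pow_powers:
  assumes "finite S"
  shows "(\<Sum>Z\<in>Pow S. (t::real) ^ card Z * a ^ card (S - Z)) = (t + a) ^ card S"
  using assms
proof (induction S rule: finite_induct)
  case (insert s S)
  have P: "Pow (insert s S) = Pow S \<union> insert s ` Pow S" by (rule Pow_insert)
  have inj: "inj_on (insert s) (Pow S)" using insert.hyps(2) by (auto simp: inj_on_def)
  have c1: "card (insert s S - Z) = Suc (card (S - Z))" if "Z \<in> Pow S" for Z
  proof -
    have "insert s S - Z = insert s (S - Z)" using that insert.hyps by auto
    then show ?thesis using insert.hyps by simp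
  qed
  have c2: "card (insert s Z) = Suc (card Z)" "insert s S - insert s Z = S - Z" if "Z \<in> Pow S" for Z
    using that insert.hyps by (auto simp: finite_subset card_insert_if)
  have "(\<Sum>Z\<in>Pow (insert s S). t ^ card Z * a ^ card (insert s S - Z))
      = (\<Sum>Z\<in>Pow S. t ^ card Z * a ^ card (insert s S - Z))
      + (\<Sum>Z\<in>insert s ` Pow S. t ^ card Z * a ^ card (insert s S - Z))"
    unfolding P using insert.hyps by (intro sum.union_disjoint) auto
  also have "(\<Sum>Z\<in>Pow S. t ^ card Z * a ^ card (insert s S - Z))
      = a * (\<Sum>Z\<in>Pow S. t ^ card Z * a ^ card (S - Z))"
    by (simp add: c1 sum_distrib_left mult_ac)
  also have "(\<Sum>Z\<in>insert s ` Pow S. t ^ card Z * a ^ card (insert s S - Z))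
      = t * (\<Sum>Z\<in>Pow S. t ^ card Z * a ^ card (S - Z))"
    unfolding sum.reindex[OF inj] sum_distrib_left o_def
    by (intro sum.cong refl) (simp only: c2 power_Suc mult_ac)
  finally show ?case using insert by (simp add: algebra_simps)
qed simp

text \<open>A union bound over the missed set \<open>Z\<close>, with each term inflated by
  \<open>(1 / t) powr (\<beta> n) * t ^ card Z \<ge> 1\<close> so that the sum is a binomial expansion.\<close>

lemma card_few_missed_le:
  fixes t a \<beta> :: real
  assumes "finite D" "0 < n" "0 < t" "t \<le> 1"
    and a: "1 - (1 - 1 / real n) ^ card D \<le> a" 
  shows "real (card {x \<in> D \<rightarrow>\<^sub>E {..<n}. real (card ({..<n} - x ` D)) \<le> \<beta> * real n})
       \<le> real n ^ card D * ((1 / t) powr \<beta> * (t + a)) ^ n"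
proof -
  let ?G = "{x \<in> D \<rightarrow>\<^sub>E {..<n}. real (card ({..<n} - x ` D)) \<le> \<beta> * real n}"
  let ?Z = "{Z \<in> Pow {..<n}. real (card Z) \<le> \<beta> * real n}"
  let ?C = "\<lambda>Z. {x \<in> D \<rightarrow>\<^sub>E {..<n}. {..<n} - Z \<subseteq> x ` D}"
  have fin: "finite (?C Z)" for Z
    using assms(1) by (auto intro: finite_subset[OF _ finite_PiE[of D "\<lambda>_. {..<n}"]])
  have a0: "0 \<le> 1 - (1 - 1 / real n) ^ card D"
    using assms(2) by (simp add: power_le_one)
  have "?G \<subseteq> (\<Union>Z\<in>?Z. ?C Z)"
  proof
    fix x assume "x \<in> ?G"
    then have "{..<n} - x ` D \<in> ?Z" "x \<in> ?C ({..<n} - x ` D)" by auto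
    then show "x \<in> (\<Union>Z\<in>?Z. ?C Z)" by blast
  qed
  then have "card ?G \<le> card (\<Union>Z\<in>?Z. ?C Z)"
    by (intro card_mono) (use fin in auto)
  also have "\<dots> \<le> (\<Sum>Z\<in>?Z. card (?C Z))" by (intro card_UN_le) simp
  finally have "real (card ?G) \<le> (\<Sum>Z\<in>?Z. real (card (?C Z)))"
    by (simp only: of_nat_sum[symmetric] of_nat_le_iff)
  also have "\<dots> \<le> (\<Sum>Z\<in>?Z. ((1 / t) powr (\<beta> * real n) * t ^ card Z) * (real n ^ card D * a ^ card ({..<n} - Z)))"
  proof (rule sum_mono)
    fix Z assume Z: "Z \<in> ?Z"
    have "real (card (?C Z)) \<le> real n ^ card D * (1 - (1 - 1 / real n) ^ card D) ^ card ({..<n} - Z)"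
      using assms by (intro card_covering_words_le) auto
    also have "\<dots> \<le> real n ^ card D * a ^ card ({..<n} - Z)"
      using a a0 by (intro mult_left_mono power_mono) auto
    finally have 1: "real (card (?C Z)) \<le> real n ^ card D * a ^ card ({..<n} - Z)" .
    have "(1 / t) powr real (card Z) \<le> (1 / t) powr (\<beta> * real n)"
      using Z assms by (intro powr_mono) auto
    moreover have "(1 / t) powr real (card Z) * t ^ card Z = 1"
      using assms by (simp add: powr_realpow power_divide)
    ultimately have 2: "1 \<le> (1 / t) powr (\<beta> * real n) * t ^ card Z"
      using assms by (metis mult_right_mono zero_le_power less_imp_le)
    have "0 \<le> real n ^ card D * a ^ card ({..<n} - Z)" using 1 of_nat_0_le_iff order.trans by blast
    then show "real (card (?C Z)) \<le> ((1 / t) powr (\<beta> * real n) * t ^ card Z) * (real n ^ card D * a ^ card ({..<n} - Z))"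
      using 1 mult_right_mono[OF 2] by fastforce
  qed
  also have "\<dots> \<le> (\<Sum>Z\<in>Pow {..<n}. ((1 / t) powr (\<beta> * real n) * t ^ card Z) * (real n ^ card D * a ^ card ({..<n} - Z)))"
    using assms a a0 by (intro sum_mono2) (auto intro!: mult_nonneg_nonneg)
  also have "\<dots> = (1 / t) powr (\<beta> * real n) * real n ^ card D * (\<Sum>Z\<in>Pow {..<n}. t ^ card Z * a ^ card ({..<n} - Z))"
    by (simp add: sum_distrib_left mult_ac)
  also have "\<dots> = (1 / t) powr (\<beta> * real n) * real n ^ card D * (t + a) ^ n"
    by (simp add: sum_Pow_powers)
  also have "(1 / t) powr (\<beta> * real n) = ((1 / t) powr \<beta>) ^ n"
    using assms by (simp add: powr_powr[symmetric] powr_realpow)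
  finally show ?thesis by (simp add: power_mult_distrib mult_ac)
qed

section \<open>Transcripts of truncated deferred acceptance\<close>

lemma card_profiles: "card (profiles n q) = fact n ^ (n * q) * fact (n * q) ^ n"
  by (simp add: profiles_def card_cartesian_product card_PiE card_permutations)

lemma finite_profiles: "finite (profiles n q)"
  unfolding profiles_def
  by (intro finite_cartesian_product finite_PiE) (auto simp: finite_permutations)

lemma profiles_permutes:
  assumes "(P, Q) \<in> profiles n q"
  shows "i < n * q \<Longrightarrow> P i permutes {..<n}" "s < n \<Longrightarrow> Q s permutes {..<n * q}"
  using assms by (auto simp: profiles_def PiE_iff)

lemma profiles_choice_less:
  assumes "(P, Q) \<in> profiles n q" "i < n * q" "j < n"
  shows "P i j < n"
  using permutes_in_image[OF profiles_permutes(1)[OF assms(1,2)], of j] assms(3) by simp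

lemma profiles_inj_priority:
  assumes "(P, Q) \<in> profiles n q" "i < n * q" "j < n"
  shows "inj_on (inv (Q (P i j))) {..<n * q}"
  using permutes_inj_on[OF permutes_inv[OF profiles_permutes(2)[OF assms(1) profiles_choice_less[OF assms]]]] .

text \<open>A slot \<open>(i, j)\<close> is the application of student \<open>i\<close> to her \<open>j\<close>-th choice, when she ends in state
  \<open>r i\<close>; a student with \<open>r i = K\<close> has used up her list and has no accepted slot.\<close>

definition slots :: "nat \<Rightarrow> nat \<Rightarrow> (nat \<Rightarrow> nat) \<Rightarrow> (nat \<times> nat) set" where
  "slots K N r = (SIGMA i:{..<N}. {..<min (Suc (r i)) K})"

definition accepted_slots :: "nat \<Rightarrow> nat \<Rightarrow> (nat \<Rightarrow> nat) \<Rightarrow> (nat \<times> nat) set" where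
  "accepted_slots K N r = (\<lambda>i. (i, r i)) ` {i. i < N \<and> r i < K}"

lemma accepted_slots_subset: "accepted_slots K N r \<subseteq> slots K N r"
  by (auto simp: accepted_slots_def slots_def)

lemma finite_slots [simp]: "finite (slots K N r)"
  by (simp add: slots_def)

lemma card_slots: "card (slots K N r) = (\<Sum>i<N. min (Suc (r i)) K)"
  by (simp add: slots_def)

lemma card_prefs_le:
  assumes "K \<le> n"
  shows "card (PiE {..<N} (\<lambda>i. {p. p permutes {..<n} \<and> (\<forall>j<min (Suc (r i)) K. p j = x (i, j))}))
           * (n - K) ^ card (slots K N r) \<le> fact n ^ N"
proof -
  have "card (PiE {..<N} (\<lambda>i. {p. p permutes {..<n} \<and> (\<forall>j<min (Suc (r i)) K. p j = x (i, j))}))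
           * (n - K) ^ card (slots K N r)
      = (\<Prod>i<N. card {p. p permutes {..<n} \<and> (\<forall>j<min (Suc (r i)) K. p j = x (i, j))}
              * (n - K) ^ min (Suc (r i)) K)"
    by (simp add: card_PiE card_slots power_sum prod.distrib)
  also have "\<dots> \<le> (\<Prod>i<N. fact n)"
    using assms by (intro prod_mono conjI card_permutations_prefix) auto
  finally show ?thesis by simp
qed

text \<open>At each school the accepted applicants precede the rejected ones, which
  \<open>card_permutations_separating\<close> counts. Slots at one school belong to different
  students, so \<open>fst\<close> preserves the sizes.\<close>

lemma card_priorities_le:
  assumes "finite D" "x \<in> quota_words n q D B" "fst ` D \<subseteq> {..<N}"
    and inj: "\<And>s. s < n \<Longrightarrow> inj_on fst (fibre D x s)"
  shows "real (card (PiE {..<n} (\<lambda>s. {\<sigma>. \<sigma> permutes {..<N} \<and>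
           (\<forall>a\<in>fst ` (B \<inter> fibre D x s). \<forall>b\<in>fst ` (fibre D x s - B). inv \<sigma> a < inv \<sigma> b)})))
       \<le> fact N ^ n * quota_weight n q D x"
proof -
  let ?S = "\<lambda>s. {\<sigma>. \<sigma> permutes {..<N} \<and>
           (\<forall>a\<in>fst ` (B \<inter> fibre D x s). \<forall>b\<in>fst ` (fibre D x s - B). inv \<sigma> a < inv \<sigma> b)}"
  have one: "real (card (?S s)) \<le> fact N * (1 / real (card (fibre D x s) choose min q (card (fibre D x s))))"
    if s: "s < n" for s
  proof -
    let ?F = "fibre D x s"
    have fin: "finite ?F" using assms(1) by (simp add: fibre_def)
    have FD: "?F \<subseteq> D" by (auto simp: fibre_def)
    have a: "card (fst ` (B \<inter> ?F)) = card (B \<inter> ?F)"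
      by (rule card_image) (rule inj_on_subset[OF inj[OF s]], auto)
    have b: "card (fst ` (?F - B)) = card (?F - B)"
      by (rule card_image) (rule inj_on_subset[OF inj[OF s]], auto)
    have c: "card (B \<inter> ?F) + card (?F - B) = card ?F"
      using card_Diff_subset_Int[of ?F B] card_mono[OF fin, of "B \<inter> ?F"] fin by (simp add: Int_commute)
    have d: "fst ` (B \<inter> ?F) \<inter> fst ` (?F - B) = {}"
      using inj[OF s] by (auto dest: inj_onD)
    have e: "fst ` (B \<inter> ?F) \<subseteq> {..<N}" "fst ` (?F - B) \<subseteq> {..<N}" using assms(3) FD by blast+
    have q: "card (B \<inter> ?F) = min q (card ?F)" using assms(2) s by (simp add: quota_words_def)
    have "card (?S s) * (card ?F choose min q (card ?F)) \<le> fact N"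
      using card_permutations_separating[OF _ e d] unfolding a b c unfolding q by simp
    then have "real (card (?S s) * (card ?F choose min q (card ?F))) \<le> real (fact N)"
      by (rule of_nat_mono)
    then have "real (card (?S s)) * real (card ?F choose min q (card ?F)) \<le> fact N" by simp
    moreover have "real (card ?F choose min q (card ?F)) > 0" by simp
    ultimately show ?thesis by (simp add: field_simps)
  qed
  have "real (card (PiE {..<n} ?S)) = (\<Prod>s<n. real (card (?S s)))" by (simp add: card_PiE)
  also have "\<dots> \<le> (\<Prod>s<n. fact N * (1 / real (card (fibre D x s) choose min q (card (fibre D x s)))))"
    by (intro prod_mono conjI one) auto
  also have "\<dots> = fact N ^ n * quota_weight n q D x"
    unfolding quota_weight_def prod.distrib by simp
  finally show ?thesis .
qed

text \<open>By \<open>rejecter_final\<close>, a school with a rejected slot has \<open>q\<close>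
  holders, all ahead of the rejected student; a school without one accepts everybody, at most
  \<open>q\<close> by \<open>card_holders_final_le\<close>. No school occurs twice on a list, hence
  the injectivity of \<open>fst\<close>.\<close>

lemma shape_word:
  assumes PQ: "(P, Q) \<in> profiles n q" and K: "K \<le> n" and N: "N = n * q"
    and r: "\<And>i. i < N \<Longrightarrow> cap_final K N q P Q i = r i"
    and x: "x = (\<lambda>(i, j)\<in>slots K N r. P i j)"
  shows "x \<in> quota_words n q (slots K N r) (accepted_slots K N r)"
    and "inj_on fst (fibre (slots K N r) x s)"
    and "a \<in> fst ` (accepted_slots K N r \<inter> fibre (slots K N r) x s) \<Longrightarrow>
         b \<in> fst ` (fibre (slots K N r) x s - accepted_slots K N r) \<Longrightarrow> inv (Q s) a < inv (Q s) b"
proof -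
  let ?D = "slots K N r" and ?B = "accepted_slots K N r"
  let ?\<rho> = "cap_final K N q P Q"
  note inj = profiles_inj_priority[OF PQ]
  have inj': "inj_on (inv (Q (P i j))) {..<N}" if "i < N" "j < K" for i j
    using inj[of i j] that K N by simp
  have D: "i < N" "j < K" "j \<le> r i" if "(i, j) \<in> ?D" for i j using that by (auto simp: slots_def)
  have xD: "x (i, j) = P i j" if "(i, j) \<in> ?D" for i j using that x by simp
  \<comment> \<open>A slot that is not accepted lies strictly below the final count, so it stands
    for a rejection.\<close>
  have rej: "j < ?\<rho> i" "i < N" if "(i, j) \<in> fibre ?D x s - ?B" for i j s
  proof -
    have ij: "(i, j) \<in> ?D" "(i, j) \<notin> ?B" using that by (auto simp: fibre_def)
    show "i < N" using D(1)[OF ij(1)] .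
    have "j \<noteq> r i" using ij D[OF ij(1)] by (auto simp: accepted_slots_def)
    then show "j < ?\<rho> i" using D[OF ij(1)] r by simp
  qed
  have rejs: "P i j = s" if "(i, j) \<in> fibre ?D x s" for i j s
    using that xD[of i j] by (auto simp: fibre_def)
  have acc: "?B \<inter> fibre ?D x s = (\<lambda>i. (i, r i)) ` holders K N P ?\<rho> s" for s
  proof -
    have "(i, r i) \<in> ?D" if "i < N" "r i < K" for i using that by (auto simp: slots_def)
    then show ?thesis
      using xD r by (auto simp: accepted_slots_def fibre_def holders_def image_iff)
  qed
  have card_acc: "card (?B \<inter> fibre ?D x s) = card (holders K N P ?\<rho> s)" for s
    unfolding acc by (intro card_image) (auto simp: inj_on_def)
  have finF: "finite (fibre ?D x s)" for s by (simp add: fibre_def)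
  have hq: "card (holders K N P ?\<rho> s) \<le> q" for s
    by (rule card_holders_final_le) (rule inj')
  have "card (?B \<inter> fibre ?D x s) = min q (card (fibre ?D x s))" for s
  proof (cases "fibre ?D x s \<subseteq> ?B")
    case True
    then have "?B \<inter> fibre ?D x s = fibre ?D x s" by blast
    then show ?thesis using hq[of s] card_acc[of s] by simp
  next
    case False
    then obtain i j where ij: "(i, j) \<in> fibre ?D x s - ?B" by fastforce
    have "card (holders K N P ?\<rho> (P i j)) = q"
      using rejecter_final(1)[where c=K and P=P and Q=Q, OF inj' rej(2,1)[OF ij]] by simp
    moreover have "P i j = s" using rejs ij by blast
    moreover have "card (?B \<inter> fibre ?D x s) \<le> card (fibre ?D x s)"
      using finF by (intro card_mono) auto
    ultimately show ?thesis using card_acc[of s] by simp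
  qed
  moreover have "x \<in> ?D \<rightarrow>\<^sub>E {..<n}"
    unfolding x using D profiles_choice_less[OF PQ] K N by fastforce
  ultimately show "x \<in> quota_words n q ?D ?B" by (simp add: quota_words_def)
  show "inj_on fst (fibre ?D x s)"
  proof (rule inj_onI)
    fix u v assume u: "u \<in> fibre ?D x s" and v: "v \<in> fibre ?D x s" and e: "fst u = fst v"
    obtain i j where u': "u = (i, j)" by force
    obtain k where v': "v = (i, k)" using e u' by (cases v) auto
    have "i < N" using u u' D(1) by (auto simp: fibre_def)
    then have "inj (P i)" using profiles_permutes(1)[OF PQ] permutes_inj N by blast
    moreover have "P i j = P i k" using rejs u v u' v' by metis
    ultimately show "u = v" using u' v' by (simp add: inj_eq)
  qed
  show "inv (Q s) a < inv (Q s) b" if a: "a \<in> fst ` (?B \<inter> fibre ?D x s)"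
    and b: "b \<in> fst ` (fibre ?D x s - ?B)"
  proof -
    from a have "a \<in> holders K N P ?\<rho> s" unfolding acc by (auto simp: image_iff)
    moreover from b obtain j where j: "(b, j) \<in> fibre ?D x s - ?B" by force
    moreover have "P b j = s" using rejs j by blast
    ultimately show ?thesis
      using rejecter_final(2)[where c=K and P=P and Q=Q, OF inj' rej(2,1)[OF j]] by simp
  qed
qed

text \<open>Union bound over words: a profile with rejection counts \<open>r\<close> lies in the box
  \<open>?P x \<times> ?Q x\<close> given by the word \<open>x\<close> of its applications.
  \<open>card_prefs_le\<close> and \<open>card_priorities_le\<close> bound the box,
  \<open>quota_weight_sum_le\<close> the sum over words.\<close>

lemma card_shape_le:
  fixes r :: "nat \<Rightarrow> nat"
  assumes K: "K \<le> n" and N: "N = n * q"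
  defines "D \<equiv> slots K N r" and "B \<equiv> accepted_slots K N r"
  shows "real (card {(P, Q) \<in> profiles n q. \<forall>i<N. cap_final K N q P Q i = r i})
           * real (n - K) ^ card D * real (card D choose card B)
       \<le> real (card (profiles n q))
           * real (card {x \<in> D \<rightarrow>\<^sub>E {..<n}. (\<Sum>s<n. min q (card (fibre D x s))) = card B})"
proof -
  let ?G = "{(P, Q) \<in> profiles n q. \<forall>i<N. cap_final K N q P Q i = r i}"
  define X where "X = {x \<in> quota_words n q D B. \<forall>s<n. inj_on fst (fibre D x s)}"
  let ?P = "\<lambda>x. PiE {..<N} (\<lambda>i. {p. p permutes {..<n} \<and> (\<forall>j<min (Suc (r i)) K. p j = x (i, j))})"
  let ?Q = "\<lambda>x. PiE {..<n} (\<lambda>s. {\<sigma>. \<sigma> permutes {..<N} \<and>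
           (\<forall>a\<in>fst ` (B \<inter> fibre D x s). \<forall>b\<in>fst ` (fibre D x s - B). inv \<sigma> a < inv \<sigma> b)})"
  have finD: "finite D" by (simp add: D_def)
  have finW: "finite (quota_words n q D B)"
    unfolding quota_words_def using finD by (auto intro: finite_subset[OF _ finite_PiE[of D "\<lambda>_. {..<n}"]])
  have finX: "finite X" using finW by (simp add: X_def)
  have finPQ: "finite (?P x \<times> ?Q x)" for x
    by (intro finite_cartesian_product finite_PiE finite_lessThan)
      (auto intro: finite_subset[OF _ finite_permutations])
  have "?G \<subseteq> (\<Union>x\<in>X. ?P x \<times> ?Q x)"
  proof clarify
    fix P Q assume PQ: "(P, Q) \<in> profiles n q" and r: "\<forall>i<N. cap_final K N q P Q i = r i"
    define x where "x = (\<lambda>(i, j)\<in>slots K N r. P i j)"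
    note w = shape_word[OF PQ K N r[rule_format] x_def, folded D_def B_def]
    have "x \<in> X" using w by (simp add: X_def)
    moreover have "P \<in> ?P x" using PQ N by (auto simp: profiles_def PiE_iff x_def slots_def)
    moreover have "Q \<in> ?Q x" using PQ N w(3) by (auto simp: profiles_def PiE_iff)
    ultimately show "(P, Q) \<in> (\<Union>x\<in>X. ?P x \<times> ?Q x)" by blast
  qed
  then have "card ?G \<le> card (\<Union>x\<in>X. ?P x \<times> ?Q x)"
    by (intro card_mono) (use finX finPQ in auto)
  also have "\<dots> \<le> (\<Sum>x\<in>X. card (?P x \<times> ?Q x))" by (intro card_UN_le finX)
  finally have "real (card ?G) \<le> (\<Sum>x\<in>X. real (card (?P x \<times> ?Q x)))"
    by (simp only: of_nat_sum[symmetric] of_nat_le_iff)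
  then have "real (card ?G) * real (n - K) ^ card D \<le> (\<Sum>x\<in>X. real (card (?P x \<times> ?Q x))) * real (n - K) ^ card D"
    by (intro mult_right_mono) auto
  also have "\<dots> = (\<Sum>x\<in>X. real (card (?P x) * (n - K) ^ card D) * real (card (?Q x)))"
    unfolding sum_distrib_right by (intro sum.cong refl) (simp add: card_cartesian_product)
  also have "\<dots> \<le> (\<Sum>x\<in>X. fact n ^ N * (fact N ^ n * quota_weight n q D x))"
  proof (intro sum_mono mult_mono)
    fix x assume x: "x \<in> X"
    have "card (?P x) * (n - K) ^ card D \<le> fact n ^ N"
      unfolding D_def using K by (rule card_prefs_le)
    then have "real (card (?P x) * (n - K) ^ card D) \<le> real (fact n ^ N)" by (rule of_nat_mono)
    then show "real (card (?P x) * (n - K) ^ card D) \<le> fact n ^ N" by simp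
    show "real (card (?Q x)) \<le> fact N ^ n * quota_weight n q D x"
      using x finD by (intro card_priorities_le) (auto simp: X_def D_def slots_def)
  qed auto
  also have "\<dots> \<le> (\<Sum>x\<in>quota_words n q D B. fact n ^ N * (fact N ^ n * quota_weight n q D x))"
    using finW by (intro sum_mono2) (auto simp: X_def quota_weight_nonneg)
  also have "\<dots> = real (card (profiles n q)) * (\<Sum>x\<in>quota_words n q D B. quota_weight n q D x)"
    by (simp add: card_profiles N sum_distrib_left mult_ac)
  finally have "real (card ?G) * real (n - K) ^ card D * real (card D choose card B)
     \<le> real (card (profiles n q)) * (\<Sum>x\<in>quota_words n q D B. quota_weight n q D x) * real (card D choose card B)"
    by (rule mult_right_mono) simp
  also have "\<dots> \<le> real (card (profiles n q))
           * real (card {x \<in> D \<rightarrow>\<^sub>E {..<n}. (\<Sum>s<n. min q (card (fibre D x s))) = card B})"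
    unfolding mult.assoc using accepted_slots_subset[of K N r]
    by (intro mult_left_mono quota_weight_sum_le) (auto simp: D_def B_def)
  finally show ?thesis .
qed

section \<open>Few students are rejected rarely\<close>

lemma sum_UN_le:
  fixes g :: "'a \<Rightarrow> real"
  assumes "finite I" "\<And>i. i \<in> I \<Longrightarrow> finite (T i)" "\<And>x. 0 \<le> g x"
  shows "sum g (\<Union>i\<in>I. T i) \<le> (\<Sum>i\<in>I. sum g (T i))"
  using assms(1,2)
proof (induction I rule: finite_induct)
  case (insert i I)
  have fin: "finite (\<Union>i\<in>I. T i)" "finite (T i)" using insert by auto
  have "sum g (T i \<union> (\<Union>i\<in>I. T i)) \<le> sum g (T i) + sum g (\<Union>i\<in>I. T i)"
    using sum.union_inter[of "T i" "\<Union>i\<in>I. T i" g] sum_nonneg[of "T i \<inter> (\<Union>i\<in>I. T i)" g]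
      assms(3) fin by simp
  then show ?case using insert by simp
qed simp

text \<open>The law of the number of failures before the first success at rate \<open>p\<close>,
  stopped at \<open>K\<close>: the mass \<open>(1 - p) ^ K\<close> of longer runs sits at
  \<open>j = K\<close>.\<close>

definition trunc_geom :: "nat \<Rightarrow> real \<Rightarrow> nat \<Rightarrow> real" where
  "trunc_geom K p j = (1 - p) ^ j * (if j < K then p else 1)"

lemma trunc_geom_nonneg: "0 \<le> p \<Longrightarrow> p \<le> 1 \<Longrightarrow> 0 \<le> trunc_geom K p j"
  by (simp add: trunc_geom_def)

lemma sum_trunc_geom: "(\<Sum>j\<le>K. trunc_geom K p j) = 1"
proof -
  have "(\<Sum>j<m. (1 - p) ^ j * p) + (1 - p) ^ m = 1" for m
    by (induction m) (simp_all add: algebra_simps)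
  moreover have "(\<Sum>j\<le>K. trunc_geom K p j) = (\<Sum>j<K. (1 - p) ^ j * p) + (1 - p) ^ K"
    unfolding lessThan_Suc_atMost[symmetric] sum.lessThan_Suc by (simp add: trunc_geom_def)
  ultimately show ?thesis by simp
qed

lemma sum_trunc_geom_low:
  assumes "0 \<le> p" "p \<le> 1" "k \<le> K"
  shows "(\<Sum>j<k. trunc_geom K p j) \<le> real k * p"
proof -
  have "(\<Sum>j<k. trunc_geom K p j) \<le> (\<Sum>j<k. p)"
  proof (rule sum_mono)
    fix j assume "j \<in> {..<k}"
    then have "trunc_geom K p j = (1 - p) ^ j * p" using assms by (simp add: trunc_geom_def)
    also have "\<dots> \<le> 1 * p" using assms by (intro mult_right_mono power_le_one) auto
    finally show "trunc_geom K p j \<le> p" by simp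
  qed
  then show ?thesis by simp
qed

definition shapes :: "nat \<Rightarrow> nat \<Rightarrow> (nat \<Rightarrow> nat) set" where
  "shapes K N = {..<N} \<rightarrow>\<^sub>E {..K}"

lemma finite_shapes [simp]: "finite (shapes K N)"
  by (simp add: shapes_def finite_PiE)

lemma sum_shapes_trunc_geom: "(\<Sum>r\<in>shapes K N. \<Prod>i<N. trunc_geom K p (r i)) = 1"
  unfolding shapes_def by (subst prod_sum_PiE[symmetric]) (simp_all add: sum_trunc_geom)

text \<open>Union bound over the set \<open>S\<close> of coordinates below \<open>k\<close>, at most
  \<open>2 ^ N\<close> sets. For fixed \<open>S\<close> the sum factorises: coordinates in
  \<open>S\<close> contribute at most \<open>k * p\<close> each, the others 1.\<close>

lemma sum_low_shapes_trunc_geom: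
  assumes p: "0 \<le> p" "p \<le> 1" and "k \<le> K" and c: "real k * p \<le> c" "0 < c" "c \<le> 1"
  shows "(\<Sum>r | r \<in> shapes K N \<and> \<delta> \<le> real (card {i. i < N \<and> r i < k}). \<Prod>i<N. trunc_geom K p (r i))
       \<le> 2 ^ N * c powr \<delta>"
proof -
  let ?L = "{r \<in> shapes K N. \<delta> \<le> real (card {i. i < N \<and> r i < k})}"
  let ?S = "{S \<in> Pow {..<N}. \<delta> \<le> real (card S)}"
  let ?T = "\<lambda>S. PiE {..<N} (\<lambda>i. if i \<in> S then {..<k} else {..K})"
  let ?g = "\<lambda>r. \<Prod>i<N. trunc_geom K p (r i)"
  have g: "0 \<le> ?g r" for r using p by (intro prod_nonneg) (auto simp: trunc_geom_nonneg)
  have finT: "finite (?T S)" for S by (intro finite_PiE) auto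
  have "?L \<subseteq> (\<Union>S\<in>?S. ?T S)"
  proof
    fix r assume r: "r \<in> ?L"
    let ?low = "{i. i < N \<and> r i < k}"
    have "?low \<in> ?S" "r \<in> ?T ?low" using r by (auto simp: shapes_def PiE_iff)
    then show "r \<in> (\<Union>S\<in>?S. ?T S)" by blast
  qed
  then have "sum ?g ?L \<le> sum ?g (\<Union>S\<in>?S. ?T S)"
    by (intro sum_mono2) (use finT g in auto)
  also have "\<dots> \<le> (\<Sum>S\<in>?S. sum ?g (?T S))"
    by (intro sum_UN_le) (use finT g in auto)
  also have "\<dots> \<le> (\<Sum>S\<in>?S. c powr \<delta>)"
  proof (rule sum_mono)
    fix S assume S: "S \<in> ?S"
    have "sum ?g (?T S) = (\<Prod>i<N. \<Sum>j\<in>(if i \<in> S then {..<k} else {..K}). trunc_geom K p j)"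
      by (subst prod_sum_PiE) auto
    also have "\<dots> \<le> (\<Prod>i<N. if i \<in> S then c else 1)"
      using sum_trunc_geom_low[OF p assms(3)] c(1)
      by (intro prod_mono conjI sum_nonneg trunc_geom_nonneg p) (auto simp: sum_trunc_geom)
    also have "\<dots> = c ^ card S"
    proof -
      have "{..<N} \<inter> S = S" using S by auto
      then show ?thesis by (simp add: prod.If_cases)
    qed
    also have "\<dots> = c powr real (card S)" using c by (simp add: powr_realpow)
    also have "\<dots> \<le> c powr \<delta>" using S c by (intro powr_mono') auto
    finally show "sum ?g (?T S) \<le> c powr \<delta>" .
  qed
  also have "\<dots> = real (card ?S) * c powr \<delta>" by simp
  also have "\<dots> \<le> 2 ^ N * c powr \<delta>"
  proof (rule mult_right_mono)
    have "card ?S \<le> card (Pow {..<N})" by (intro card_mono) auto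
    also have "\<dots> = 2 ^ N" by (simp add: card_Pow)
    finally show "real (card ?S) \<le> 2 ^ N" using of_nat_mono by fastforce
  qed simp
  finally show ?thesis .
qed

lemma card_accepted_slots: "card (accepted_slots K N r) = card {i. i < N \<and> r i < K}"
  unfolding accepted_slots_def by (intro card_image) (auto simp: inj_on_def)

text \<open>Each student has \<open>r i\<close> rejected slots and, unless she reached
  \<open>K\<close>, one accepted slot.\<close>

lemma card_slots_eq:
  assumes "r \<in> shapes K N"
  shows "card (slots K N r) = card (accepted_slots K N r) + (\<Sum>i<N. r i)"
proof -
  have "card (slots K N r) = (\<Sum>i<N. (if r i < K then 1 else 0) + r i)"
    unfolding card_slots using assms by (intro sum.cong refl) (force simp: shapes_def PiE_iff)
  also have "\<dots> = card {i. i < N \<and> r i < K} + (\<Sum>i<N. r i)"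
    by (simp add: sum.distrib sum.If_cases Int_def)
  finally show ?thesis by (simp add: card_accepted_slots)
qed

text \<open>Accepted slots are the successes and rejections the failures; the weight in
  \<open>inverse_binomial_le\<close> thus becomes a product over students.\<close>

lemma prod_trunc_geom:
  "(\<Prod>i<N. trunc_geom K p (r i)) = p ^ card (accepted_slots K N r) * (1 - p) ^ (\<Sum>i<N. r i)"
  unfolding trunc_geom_def card_accepted_slots
  by (simp add: prod.distrib power_sum prod.If_cases Int_def)

lemma one_minus_inverse_power_ge:
  assumes "2 \<le> n"
  shows "exp (-2) \<le> (1 - 1 / real n) ^ n"
proof -
  let ?x = "1 / real n"
  have x: "0 \<le> ?x" "?x \<le> 1 / 2" using assms by (auto simp: field_simps)
  have "- ?x - 2 * ?x\<^sup>2 \<le> ln (1 - ?x)" using ln_one_minus_pos_lower_bound[OF x] .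
  then have "real n * (- ?x - 2 * ?x\<^sup>2) \<le> real n * ln (1 - ?x)" by (intro mult_left_mono) auto
  moreover have "real n * (- ?x - 2 * ?x\<^sup>2) = -1 - 2 * ?x"
    using assms by (simp add: field_simps power2_eq_square)
  ultimately have "-2 \<le> real n * ln (1 - ?x)" using x by linarith
  then have "exp (-2) \<le> exp (real n * ln (1 - ?x))" by simp
  also have "\<dots> = (1 - ?x) ^ n" using x by (simp add: exp_of_nat_mult)
  finally show ?thesis .
qed

text \<open>There are as many unfilled places as students with used-up lists, and each of these
  students accounts for \<open>K\<close> applications, so at most \<open>\<beta> * n\<close> places
  are unfilled. An empty school has \<open>q\<close> of them; hence few bins are missed and
  \<open>card_few_missed_le\<close> applies.\<close>

lemma card_underfilled_words_le:
  fixes r :: "nat \<Rightarrow> nat" and \<beta> t :: real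
  assumes r: "r \<in> shapes K N" and N: "N = n * q" and q: "0 < q" and n: "2 \<le> n"
    and K: "0 < K" and t: "0 < t" "t \<le> 1" and lam: "real lam \<le> \<beta> * real K"
    and M: "card (slots K N r) < lam * n"
  shows "real (card {x \<in> slots K N r \<rightarrow>\<^sub>E {..<n}.
             (\<Sum>s<n. min q (card (fibre (slots K N r) x s))) = card (accepted_slots K N r)})
       \<le> real n ^ card (slots K N r) * ((1 / t) powr \<beta> * (t + (1 - exp (-2) ^ lam))) ^ n"
proof -
  let ?D = "slots K N r" and ?A = "card (accepted_slots K N r)"
  have Kh: "K * (N - ?A) \<le> card ?D"
  proof -
    have "card {i. i < N \<and> r i < K} + card {i. i < N \<and> r i = K} = N"
    proof -
      have "{..<N} = {i. i < N \<and> r i < K} \<union> {i. i < N \<and> r i = K}"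
        using r by (force simp: shapes_def PiE_iff)
      then have "card {..<N} = card ({i. i < N \<and> r i < K} \<union> {i. i < N \<and> r i = K})" by simp
      also have "\<dots> = card {i. i < N \<and> r i < K} + card {i. i < N \<and> r i = K}"
        by (intro card_Un_disjoint) auto
      finally show ?thesis by simp
    qed
    then have "N - ?A = card {i. i < N \<and> r i = K}" by (simp add: card_accepted_slots)
    then have "K * (N - ?A) = (\<Sum>i | i < N \<and> r i = K. r i)" by simp
    also have "\<dots> \<le> (\<Sum>i<N. r i)" by (intro sum_mono2) auto
    also have "\<dots> \<le> card ?D" using card_slots_eq[OF r] by simp
    finally show ?thesis .
  qed
  have missed: "real (card ({..<n} - x ` ?D)) \<le> \<beta> * real n"
    if x: "x \<in> ?D \<rightarrow>\<^sub>E {..<n}" "(\<Sum>s<n. min q (card (fibre ?D x s))) = ?A" for x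
  proof -
    define Z where "Z = {..<n} - x ` ?D"
    have "(\<Sum>s<n. min q (card (fibre ?D x s))) \<le> (\<Sum>s\<in>{..<n}. if s \<in> Z then 0 else q)"
    proof (rule sum_mono)
      fix s
      have "s \<in> Z \<Longrightarrow> fibre ?D x s = {}" by (auto simp: fibre_def Z_def)
      then show "min q (card (fibre ?D x s)) \<le> (if s \<in> Z then 0 else q)" by (cases "s \<in> Z") auto
    qed
    also have "\<dots> = q * card ({..<n} - Z)" by (simp add: sum.If_cases Diff_eq)
    also have "card ({..<n} - Z) = n - card Z" by (subst card_Diff_subset) (auto simp: Z_def)
    finally have "?A \<le> q * (n - card Z)" using x by simp
    also have "\<dots> = N - q * card Z" by (simp add: N diff_mult_distrib2 mult.commute)
    finally have "?A \<le> N - q * card Z" .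
    moreover have "q * card Z \<le> N"
    proof -
      have "card Z \<le> n" using card_mono[of "{..<n}" Z] by (auto simp: Z_def)
      then show ?thesis by (simp add: N mult.commute)
    qed
    ultimately have "q * card Z \<le> N - ?A" by linarith
    moreover have "1 * card Z \<le> q * card Z" using q by (intro mult_le_mono1) simp
    ultimately have "card Z \<le> N - ?A" by linarith
    then have "K * card Z \<le> card ?D" using Kh by (meson le_trans mult_le_mono2)
    then have "K * card Z \<le> lam * n" using M by linarith
    then have "real K * real (card Z) \<le> real lam * real n" by (simp flip: of_nat_mult)
    also have "\<dots> \<le> \<beta> * real K * real n" using lam by (intro mult_right_mono) auto
    finally have "real K * real (card Z) \<le> real K * (\<beta> * real n)" by (simp add: mult_ac)
    then show ?thesis using K by (simp add: Z_def)
  qed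
  \<comment> \<open>Fewer than \<open>lam * n\<close> balls miss a given bin with probability at
    least \<open>exp (-2) ^ lam\<close>.\<close>
  have "exp (-2) ^ lam \<le> ((1 - 1 / real n) ^ n) ^ lam"
    using one_minus_inverse_power_ge[OF n] by (intro power_mono) auto
  also have "\<dots> = (1 - 1 / real n) ^ (lam * n)" by (simp only: power_mult[symmetric] mult.commute)
  also have "\<dots> \<le> (1 - 1 / real n) ^ card ?D"
    using M n by (intro power_decreasing) auto
  finally have a: "1 - (1 - 1 / real n) ^ card ?D \<le> 1 - exp (-2) ^ lam" by simp
  have "real (card {x \<in> ?D \<rightarrow>\<^sub>E {..<n}. (\<Sum>s<n. min q (card (fibre ?D x s))) = ?A})
      \<le> real (card {x \<in> ?D \<rightarrow>\<^sub>E {..<n}. real (card ({..<n} - x ` ?D)) \<le> \<beta> * real n})"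
    using missed by (intro of_nat_mono card_mono finite_subset[OF _ finite_PiE[of ?D "\<lambda>_. {..<n}"]]) auto
  also have "\<dots> \<le> real n ^ card ?D * ((1 / t) powr \<beta> * (t + (1 - exp (-2) ^ lam))) ^ n"
    using n t a by (intro card_few_missed_le) auto
  finally show ?thesis .
qed

text \<open>For \<open>n \<ge> 2 * K\<close> each factor is at most \<open>exp (2 * K / n)\<close>,
  and there are at most \<open>K * n * q\<close> of them: replacing distinct choices by independent
  ones costs a factor that does not grow with \<open>n\<close>.\<close>

lemma truncation_factor_le:
  assumes "0 < K" "2 * K \<le> n" "M \<le> K * (n * q)"
  shows "(real n / real (n - K)) ^ M \<le> exp (2 * real K ^ 2 * real q)"
proof -
  have n: "0 < n" "K < n" using assms by auto
  have d: "real (n - K) = real n - real K" using assms by (simp add: of_nat_diff)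
  have "real n / real (n - K) \<le> 1 + 2 * real K / real n"
  proof -
    have "real n * real n \<le> (real n + 2 * real K) * (real n - real K)"
    proof -
      have "real K * (2 * real K) \<le> real K * real n" using assms by (intro mult_left_mono) auto
      then show ?thesis by (simp add: algebra_simps)
    qed
    moreover have "real n - real K > 0" using n by simp
    ultimately have "real n / (real n - real K) \<le> (real n + 2 * real K) / real n"
      using n by (simp add: field_simps)
    then show ?thesis using n d by (simp add: field_simps)
  qed
  also have "\<dots> \<le> exp (2 * real K / real n)" by (rule exp_ge_add_one_self)
  finally have b: "real n / real (n - K) \<le> exp (2 * real K / real n)" .
  have "(real n / real (n - K)) ^ M \<le> exp (2 * real K / real n) ^ M"
    using b by (intro power_mono) auto
  also have "\<dots> \<le> exp (2 * real K / real n) ^ (K * (n * q))"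
    using assms by (intro power_increasing) auto
  also have "\<dots> = exp (real (K * (n * q)) * (2 * real K / real n))" by (rule exp_of_nat_mult[symmetric])
  also have "real (K * (n * q)) * (2 * real K / real n) = 2 * real K ^ 2 * real q"
    using n by (simp add: field_simps power2_eq_square)
  finally show ?thesis .
qed

text \<open>The binomial coefficient of \<open>card_shape_le\<close> is traded through
  \<open>inverse_binomial_le\<close> for independent truncated geometric variables, with the
  acceptance rate \<open>p\<close> of \<open>r\<close> itself.\<close>

lemma shape_probability_le:
  fixes r :: "nat \<Rightarrow> nat"
  assumes r: "r \<in> shapes K N" and N: "N = n * q" "0 < N" and K: "0 < K" "2 * K \<le> n"
  defines "D \<equiv> slots K N r" and "B \<equiv> accepted_slots K N r"
  defines "p \<equiv> real (card B) / real (card D)"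
  shows "real (card {(P, Q) \<in> profiles n q. \<forall>i<N. cap_final K N q P Q i = r i})
       \<le> real (card (profiles n q)) * (exp (2 * real K ^ 2 * real q) * real (K * N + 1)) *
          (real (card {x \<in> D \<rightarrow>\<^sub>E {..<n}. (\<Sum>s<n. min q (card (fibre D x s))) = card B}) / real n ^ card D)
          * (\<Prod>i<N. trunc_geom K p (r i))"
    (is "real (card ?G) \<le> _ * _ * (real (card ?W) / _) * _")
proof -
  have n: "0 < n" "K < n" using K by auto
  define M A where "M = card D" and "A = card B"
  define T where "T = (\<Sum>i<N. r i)"
  have MAT: "M = A + T" using card_slots_eq[OF r] by (simp add: M_def A_def T_def D_def B_def)
  have MK: "M \<le> K * N"
  proof -
    have "M \<le> (\<Sum>i<N. K)" unfolding M_def D_def card_slots by (intro sum_mono) simp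
    then show ?thesis by (simp add: mult.commute)
  qed
  have M0: "0 < M"
  proof -
    have "N = (\<Sum>i<N. 1)" by simp
    also have "\<dots> \<le> M" unfolding M_def D_def card_slots using K by (intro sum_mono) simp
    finally show ?thesis using N(2) by linarith
  qed
  have pos: "0 < real (n - K) ^ M" "0 < real (M choose A)"
    using n MAT by auto
  have "real (card ?G) * (real (n - K) ^ M * real (M choose A)) \<le> real (card (profiles n q)) * real (card ?W)"
    using card_shape_le[of K n N q r] K N unfolding M_def A_def D_def B_def by (simp add: mult.assoc)
  then have "real (card ?G) \<le> real (card (profiles n q)) * real (card ?W) / (real (n - K) ^ M * real (M choose A))"
    using pos by (simp add: pos_le_divide_eq)
  also have "\<dots> = real (card (profiles n q)) * (real (card ?W) / real n ^ M)
      * ((real n / real (n - K)) ^ M * (1 / real (M choose A)))"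
    using n by (simp add: power_divide)
  also have "\<dots> \<le> real (card (profiles n q)) * (real (card ?W) / real n ^ M)
      * (exp (2 * real K ^ 2 * real q) * (real (K * N + 1) * (\<Prod>i<N. trunc_geom K p (r i))))"
  proof (intro mult_left_mono mult_mono)
    show "(real n / real (n - K)) ^ M \<le> exp (2 * real K ^ 2 * real q)"
      using K MK N by (intro truncation_factor_le) auto
    have "1 / real (M choose A) \<le> real (A + T + 1) * (p ^ A * (1 - p) ^ T)"
      unfolding MAT using M0 MAT by (intro inverse_binomial_le) (auto simp: p_def M_def[symmetric] A_def[symmetric])
    also have "\<dots> \<le> real (K * N + 1) * (p ^ A * (1 - p) ^ T)"
    proof (rule mult_right_mono)
      show "real (A + T + 1) \<le> real (K * N + 1)" using MK unfolding MAT by (simp only: of_nat_le_iff add_le_cancel_right)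
      have "p \<le> 1" "0 \<le> p" using M0 MAT by (auto simp: p_def M_def[symmetric] A_def[symmetric])
      then show "0 \<le> p ^ A * (1 - p) ^ T" by simp
    qed
    also have "p ^ A * (1 - p) ^ T = (\<Prod>i<N. trunc_geom K p (r i))"
      by (simp add: prod_trunc_geom A_def B_def T_def)
    finally show "1 / real (M choose A) \<le> real (K * N + 1) * (\<Prod>i<N. trunc_geom K p (r i))" .
  qed auto
  finally show ?thesis by (simp add: M_def mult_ac)
qed

text \<open>With fewer than \<open>lam * n\<close> applications almost every school still receives one, which holds for few
  words (the first summand); otherwise the acceptance rate is at most \<open>q / lam\<close>, so that few students
  stop early (the second summand).\<close>

lemma low_rank_probability_le:
  fixes \<delta> \<beta> t :: real
  assumes N: "N = n * q" and q: "0 < q" and n: "2 \<le> n"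
    and K: "0 < K" "2 * K \<le> n" and k: "0 < k" "k \<le> K"
    and t: "0 < t" "t \<le> 1" and lam: "real lam \<le> \<beta> * real K" "k * q \<le> lam"
  shows "real (card {(P, Q) \<in> profiles n q. \<delta> * real N \<le> real (card {i. i < N \<and> cap_final K N q P Q i < k})})
       \<le> real (card (profiles n q)) * (exp (2 * real K ^ 2 * real q) * real (K * N + 1) ^ 3 *
          (((1 / t) powr \<beta> * (t + (1 - exp (-2) ^ lam))) ^ n
             + (2 ^ q * (real (k * q) / real lam) powr (\<delta> * real q)) ^ n))"
    (is "real (card ?G) \<le> real (card ?P) * (?E * _ * (?y + ?z))")
proof -
  let ?L = "{r \<in> shapes K N. \<delta> * real N \<le> real (card {i. i < N \<and> r i < k})}"
  let ?Gr = "\<lambda>r. {(P, Q) \<in> profiles n q. \<forall>i<N. cap_final K N q P Q i = r i}"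
  let ?A = "\<lambda>r. card (accepted_slots K N r)" and ?T = "\<lambda>r::nat \<Rightarrow> nat. \<Sum>i<N. r i"
  \<comment> \<open>The acceptance rate as a function of the numbers of accepted and of rejected
    slots.\<close>
  define pr where "pr = (\<lambda>(a, b). real a / real (a + b))"
  let ?g = "\<lambda>u r. \<Prod>i<N. trunc_geom K (pr u) (r i)"
  let ?z' = "\<lambda>u. if fst u + snd u < lam * n then ?y else (1::real)"
  have N0: "0 < N" using N q n by simp
  have finL: "finite ?L" by simp
  have finG: "finite (?Gr r)" for r by (rule finite_subset[OF _ finite_profiles[of n q]]) auto
  have lam0: "0 < lam" using lam(2) k q by (metis gr_zeroI le_zero_eq mult_is_0 not_gr_zero)
  have y0: "0 \<le> ?y" and z0: "0 \<le> ?z"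
  proof -
    have "exp (-2) ^ lam \<le> (1::real)" by (intro power_le_one) auto
    then show "0 \<le> ?y" using t by (intro zero_le_power mult_nonneg_nonneg) auto
    show "0 \<le> ?z" by simp
  qed
  have pr01: "0 \<le> pr u" "pr u \<le> 1" for u
    by (auto simp: pr_def divide_le_eq split: prod.splits)
  have g0: "0 \<le> ?g u r" for u r using pr01 by (intro prod_nonneg) (auto simp: trunc_geom_nonneg)
  have "?G \<subseteq> (\<Union>r\<in>?L. ?Gr r)"
  proof clarify
    fix P Q assume PQ: "(P, Q) \<in> profiles n q"
      and l: "\<delta> * real N \<le> real (card {i. i < N \<and> cap_final K N q P Q i < k})"
    let ?r = "restrict (cap_final K N q P Q) {..<N}"
    have "{i. i < N \<and> ?r i < k} = {i. i < N \<and> cap_final K N q P Q i < k}" by auto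
    then have "?r \<in> ?L" using l cap_final_le by (simp add: shapes_def)
    moreover have "(P, Q) \<in> ?Gr ?r" using PQ by simp
    ultimately show "(P, Q) \<in> (\<Union>r\<in>?L. ?Gr r)" by blast
  qed
  then have "card ?G \<le> card (\<Union>r\<in>?L. ?Gr r)" by (intro card_mono finite_UN_I finL finG)
  also have "\<dots> \<le> (\<Sum>r\<in>?L. card (?Gr r))" by (intro card_UN_le finL)
  finally have "real (card ?G) \<le> (\<Sum>r\<in>?L. real (card (?Gr r)))"
    by (simp only: of_nat_sum[symmetric] of_nat_le_iff)
  also have "\<dots> \<le> (\<Sum>r\<in>?L. real (card ?P) * (?E * real (K * N + 1)) * (?z' (?A r, ?T r) * ?g (?A r, ?T r) r))"
  proof (rule sum_mono)
    fix r assume "r \<in> ?L"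
    then have r: "r \<in> shapes K N" by simp
    let ?D = "slots K N r"
    let ?W = "{x \<in> ?D \<rightarrow>\<^sub>E {..<n}. (\<Sum>s<n. min q (card (fibre ?D x s))) = ?A r}"
    have D: "card ?D = ?A r + ?T r" by (rule card_slots_eq[OF r])
    have "real (card ?W) / real n ^ card ?D \<le> ?z' (?A r, ?T r)"
    proof (cases "card ?D < lam * n")
      case True
      have "real (card ?W) \<le> real n ^ card ?D * ?y"
        using card_underfilled_words_le[OF r N q n K(1) t lam(1) True] .
      then show ?thesis using True n D by (simp add: divide_le_eq mult.commute)
    next
      case False
      have "card ?W \<le> card (?D \<rightarrow>\<^sub>E {..<n})" by (intro card_mono finite_PiE) auto
      also have "\<dots> = n ^ card ?D" by (simp add: card_PiE)
      finally have "real (card ?W) \<le> real (n ^ card ?D)" by (rule of_nat_mono)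
      then have "real (card ?W) / real n ^ card ?D \<le> 1" using n by (simp add: divide_le_eq)
      then show ?thesis using False by (simp add: D)
    qed
    then have "real (card ?P) * (?E * real (K * N + 1)) * (real (card ?W) / real n ^ card ?D) * ?g (?A r, ?T r) r
       \<le> real (card ?P) * (?E * real (K * N + 1)) * ?z' (?A r, ?T r) * ?g (?A r, ?T r) r"
      using g0 by (intro mult_right_mono mult_left_mono) auto
    moreover have "real (card (?Gr r))
       \<le> real (card ?P) * (?E * real (K * N + 1)) * (real (card ?W) / real n ^ card ?D) * ?g (?A r, ?T r) r"
      using shape_probability_le[OF r N N0 K] by (simp only: D pr_def split)
    ultimately show "real (card (?Gr r))
       \<le> real (card ?P) * (?E * real (K * N + 1)) * (?z' (?A r, ?T r) * ?g (?A r, ?T r) r)"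
      by (simp only: mult.assoc) 
  qed
  also have "\<dots> = real (card ?P) * (?E * real (K * N + 1)) * (\<Sum>r\<in>?L. ?z' (?A r, ?T r) * ?g (?A r, ?T r) r)"
    by (simp only: sum_distrib_left)
  also have "\<dots> \<le> real (card ?P) * (?E * real (K * N + 1)) * (real (K * N + 1) ^ 2 * (?y + ?z))"
  proof (intro mult_left_mono)
    let ?I = "{..N} \<times> {..K * N}"
    have img: "(\<lambda>r. (?A r, ?T r)) ` ?L \<subseteq> ?I"
    proof (rule image_subsetI)
      fix r assume "r \<in> ?L"
      then have r: "\<And>i. i < N \<Longrightarrow> r i \<le> K" by (auto simp: shapes_def PiE_iff)
      have "card {i. i < N \<and> r i < K} \<le> card {..<N}" by (intro card_mono) auto
      moreover have "(\<Sum>i<N. r i) \<le> (\<Sum>i<N. K)" by (rule sum_mono) (use r in auto)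
      ultimately show "(?A r, ?T r) \<in> ?I" by (simp add: card_accepted_slots mult.commute)
    qed
    \<comment> \<open>The rate varies with \<open>r\<close>. Grouping by the numbers of accepted and
      rejected slots fixes it, so that \<open>?g u\<close> is a probability distribution on
      \<open>shapes K N\<close>; there are only polynomially many groups.\<close>
    have "(\<Sum>r\<in>?L. ?z' (?A r, ?T r) * ?g (?A r, ?T r) r)
        = (\<Sum>u\<in>?I. \<Sum>r\<in>{r \<in> ?L. (?A r, ?T r) = u}. ?z' (?A r, ?T r) * ?g (?A r, ?T r) r)"
      by (rule sum.group[symmetric, OF finL _ img]) simp
    also have "\<dots> \<le> (\<Sum>u\<in>?I. ?y + ?z)"
    proof (rule sum_mono)
      fix u assume u: "u \<in> ?I"
      have "(\<Sum>r\<in>{r \<in> ?L. (?A r, ?T r) = u}. ?z' (?A r, ?T r) * ?g (?A r, ?T r) r)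
          = (\<Sum>r\<in>{r \<in> ?L. (?A r, ?T r) = u}. ?z' u * ?g u r)"
        by (intro sum.cong refl) auto
      also have "\<dots> \<le> (\<Sum>r\<in>?L. ?z' u * ?g u r)"
        using y0 g0 by (intro sum_mono2) auto
      also have "\<dots> = ?z' u * (\<Sum>r\<in>?L. ?g u r)" by (simp only: sum_distrib_left)
      also have "\<dots> \<le> ?y + ?z"
      proof (cases "fst u + snd u < lam * n")
        case True
        have "(\<Sum>r\<in>?L. ?g u r) \<le> (\<Sum>r\<in>shapes K N. ?g u r)"
          using g0 by (intro sum_mono2) auto
        also have "\<dots> = 1" by (rule sum_shapes_trunc_geom)
        finally have "?y * (\<Sum>r\<in>?L. ?g u r) \<le> ?y * 1" using y0 by (intro mult_left_mono)
        then have "?y * (\<Sum>r\<in>?L. ?g u r) \<le> ?y + ?z" using z0 by linarith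
        then show ?thesis using True by (simp only: if_True)
      next
        case False
        let ?c = "real (k * q) / real lam"
        have M: "real lam * real n \<le> real (fst u + snd u)"
          using False by (simp only: not_less of_nat_mult[symmetric] of_nat_le_iff)
        have Mpos: "0 < real (fst u + snd u)" 
        proof -
          have "0 < real lam * real n" using lam0 n by simp
          then show ?thesis using M by linarith
        qed
        have "real k * pr u \<le> ?c"
        proof -
          have "real (fst u) * real lam \<le> real N * real lam" using u by (intro mult_right_mono) auto
          also have "\<dots> = real q * (real lam * real n)" by (simp add: N)
          also have "\<dots> \<le> real q * real (fst u + snd u)" using M by (intro mult_left_mono) auto
          finally have "pr u \<le> real q / real lam"
            using Mpos lam0 by (simp add: pr_def split_beta field_simps)
          then have "real k * pr u \<le> real k * (real q / real lam)" by (intro mult_left_mono) auto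
          then show ?thesis by simp
        qed
        moreover have "0 < ?c" using k q lam0 by simp
        moreover have "?c \<le> 1" using lam(2) lam0 by (simp only: divide_le_eq_1_pos of_nat_0_less_iff of_nat_le_iff)
        ultimately have "(\<Sum>r\<in>?L. ?g u r) \<le> 2 ^ N * ?c powr (\<delta> * real N)"
          using sum_low_shapes_trunc_geom[OF pr01 k(2)] by blast
        also have "\<dots> = ?z"
        proof -
          have "?c powr (\<delta> * real N) = (?c powr (\<delta> * real q)) powr real n"
            by (simp add: powr_powr N mult_ac)
          also have "\<dots> = (?c powr (\<delta> * real q)) ^ n" using \<open>0 < ?c\<close>
            by (intro powr_realpow) (metis powr_gt_zero less_irrefl)
          finally show ?thesis by (simp add: N power_mult_distrib power_mult[symmetric] mult.commute)
        qed
        finally have "(\<Sum>r\<in>?L. ?g u r) \<le> ?y + ?z" using y0 by linarith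
        then show ?thesis using False by (simp only: if_False mult_1_left)
      qed
      finally show "(\<Sum>r\<in>{r \<in> ?L. (?A r, ?T r) = u}. ?z' (?A r, ?T r) * ?g (?A r, ?T r) r) \<le> ?y + ?z" .
    qed
    also have "\<dots> = real ((N + 1) * (K * N + 1)) * (?y + ?z)" by simp
    also have "\<dots> \<le> real (K * N + 1) ^ 2 * (?y + ?z)"
    proof (rule mult_right_mono)
      have "N + 1 \<le> K * N + 1" using K by simp
      then have "(N + 1) * (K * N + 1) \<le> (K * N + 1) * (K * N + 1)" by (rule mult_le_mono1)
      then show "real ((N + 1) * (K * N + 1)) \<le> real (K * N + 1) ^ 2"
        by (simp only: power2_eq_square of_nat_mult[symmetric] of_nat_le_iff)
    qed (use y0 z0 in simp)
    finally show "(\<Sum>r\<in>?L. ?z' (?A r, ?T r) * ?g (?A r, ?T r) r) \<le> real (K * N + 1) ^ 2 * (?y + ?z)" .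
  qed simp
  also have "\<dots> = real (card ?P) * (?E * real (K * N + 1) ^ 3 * (?y + ?z))"
    by (simp add: power2_eq_square power3_eq_cube mult_ac)
  finally show ?thesis .
qed

section \<open>Choices avoiding a large set of schools\<close>

text \<open>Sums \<open>card_permutations_prefix\<close> over the \<open>card U ^ k\<close> words
  that may serve as prefix.\<close>

lemma card_permutations_avoiding:
  assumes "k \<le> n" "U \<subseteq> {..<n}"
  shows "card {p. p permutes {..<n} \<and> (\<forall>j<k. p j \<in> U)} * (n - k) ^ k \<le> fact n * card U ^ k"
proof -
  let ?S = "\<lambda>w. {p. p permutes {..<n} \<and> (\<forall>j<k. p j = w j)}"
  have finU: "finite U" using assms finite_subset by blast
  have fin: "finite (?S w)" for w
    by (rule finite_subset[OF _ finite_permutations[of "{..<n}"]]) auto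
  have "{p. p permutes {..<n} \<and> (\<forall>j<k. p j \<in> U)} \<subseteq> (\<Union>w\<in>{..<k} \<rightarrow>\<^sub>E U. ?S w)"
  proof clarify
    fix p assume p: "p permutes {..<n}" "\<forall>j<k. p j \<in> U"
    then have "restrict p {..<k} \<in> {..<k} \<rightarrow>\<^sub>E U" "p \<in> ?S (restrict p {..<k})" by auto
    then show "p \<in> (\<Union>w\<in>{..<k} \<rightarrow>\<^sub>E U. ?S w)" by blast
  qed
  then have "card {p. p permutes {..<n} \<and> (\<forall>j<k. p j \<in> U)} \<le> card (\<Union>w\<in>{..<k} \<rightarrow>\<^sub>E U. ?S w)"
    using fin finU by (intro card_mono finite_UN_I finite_PiE) auto
  also have "\<dots> \<le> (\<Sum>w\<in>{..<k} \<rightarrow>\<^sub>E U. card (?S w))"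
    using finU by (intro card_UN_le finite_PiE) auto
  finally have "card {p. p permutes {..<n} \<and> (\<forall>j<k. p j \<in> U)} * (n - k) ^ k
      \<le> (\<Sum>w\<in>{..<k} \<rightarrow>\<^sub>E U. card (?S w)) * (n - k) ^ k" by (rule mult_le_mono1)
  also have "\<dots> = (\<Sum>w\<in>{..<k} \<rightarrow>\<^sub>E U. card (?S w) * (n - k) ^ k)" by (rule sum_distrib_right)
  also have "\<dots> \<le> (\<Sum>w\<in>{..<k} \<rightarrow>\<^sub>E U. fact n)"
    using assms(1) by (intro sum_mono card_permutations_prefix) auto
  also have "\<dots> = fact n * card U ^ k" by (simp add: card_PiE mult.commute)
  finally show ?thesis .
qed

text \<open>The exceptional event of the closed-set argument, stated for arbitrary \<open>B\<close>
  and \<open>T\<close> instead of sets derived from the matching, so that a union bound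
  applies.\<close>

definition avoiding_profiles :: "nat \<Rightarrow> nat \<Rightarrow> nat \<Rightarrow> real \<Rightarrow> real
    \<Rightarrow> ((nat \<Rightarrow> nat \<Rightarrow> nat) \<times> (nat \<Rightarrow> nat \<Rightarrow> nat)) set" where
  "avoiding_profiles n q k b c = {(P, Q) \<in> profiles n q.
     \<exists>B T. B \<subseteq> {..<n*q} \<and> T \<subseteq> {..<n} \<and> b \<le> real (card B) \<and> c \<le> real (card T) \<and>
       (\<forall>i\<in>B. \<forall>j<k. P i j \<notin> T)}"

text \<open>Union bound over at most \<open>2 ^ (n * q + n)\<close> pairs. For a fixed pair the
  students of \<open>B\<close> independently avoid \<open>T\<close> in their first \<open>k\<close>
  choices, each with probability at most \<open>\<theta> ^ k\<close>, as \<open>\<theta>\<close>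
  dominates \<open>(n - card T) / (n - k)\<close>.\<close>

lemma card_avoiding_profiles_le:
  fixes b \<tau> \<theta> :: real
  assumes "k < n" "0 < \<theta>" "\<theta> \<le> 1" and \<theta>: "(1 - \<tau>) * real n \<le> \<theta> * real (n - k)"
  shows "real (card (avoiding_profiles n q k b (\<tau> * real n)))
       \<le> real (card (profiles n q)) * (2 ^ (n * q + n) * \<theta> powr (real k * b))"
proof -
  let ?N = "n * q"
  let ?Z = "{(B, T) \<in> Pow {..<?N} \<times> Pow {..<n}. b \<le> real (card B) \<and> \<tau> * real n \<le> real (card T)}"
  let ?av = "\<lambda>T. {p. p permutes {..<n} \<and> (\<forall>j<k. p j \<in> {..<n} - T)}"
  let ?F = "\<lambda>(B, T). PiE {..<?N} (\<lambda>i. if i \<in> B then ?av T else {p. p permutes {..<n}})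
              \<times> PiE {..<n} (\<lambda>_. {p. p permutes {..<?N}})"
  have finZ: "finite ?Z" by (rule finite_subset[of _ "Pow {..<?N} \<times> Pow {..<n}"]) auto
  have finav: "finite (?av T)" for T
    by (rule finite_subset[OF _ finite_permutations[of "{..<n}"]]) auto
  have finF: "finite (?F u)" for u
    by (cases u) (auto intro!: finite_cartesian_product finite_PiE simp: finite_permutations finav)
  have av: "real (card (?av T)) \<le> fact n * \<theta> ^ k" if T: "T \<subseteq> {..<n}" "\<tau> * real n \<le> real (card T)" for T
  proof -
    have "card (?av T) * (n - k) ^ k \<le> fact n * card ({..<n} - T) ^ k"
      using assms by (intro card_permutations_avoiding) auto
    then have "real (card (?av T) * (n - k) ^ k) \<le> real (fact n * card ({..<n} - T) ^ k)"
      by (rule of_nat_mono)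
    then have 1: "real (card (?av T)) * real (n - k) ^ k \<le> fact n * real (card ({..<n} - T)) ^ k" by simp
    have "card T \<le> n" using T card_mono[of "{..<n}" T] by auto
    then have "real (card ({..<n} - T)) = real n - real (card T)"
      using T finite_subset[OF T(1)] by (simp add: card_Diff_subset of_nat_diff)
    also have "\<dots> \<le> \<theta> * real (n - k)" using T(2) \<theta> by (simp add: algebra_simps)
    finally have "fact n * real (card ({..<n} - T)) ^ k \<le> fact n * (\<theta> * real (n - k)) ^ k"
      by (intro mult_left_mono power_mono) auto
    with 1 have "real (card (?av T)) * real (n - k) ^ k \<le> fact n * (\<theta> * real (n - k)) ^ k"
      by (rule order.trans)
    then have "real (card (?av T)) * real (n - k) ^ k \<le> (fact n * \<theta> ^ k) * real (n - k) ^ k"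
      by (simp only: power_mult_distrib mult.assoc)
    then show ?thesis using assms(1) by (simp add: mult_le_cancel_right)
  qed
  have one: "real (card (?F u)) \<le> real (card (profiles n q)) * \<theta> powr (real k * b)" if u: "u \<in> ?Z" for u
  proof -
    obtain B T where BT: "u = (B, T)" "B \<subseteq> {..<?N}" "T \<subseteq> {..<n}" "b \<le> real (card B)"
      "\<tau> * real n \<le> real (card T)" using u by auto
    have card_F: "real (card (?F u))
        = (\<Prod>i<?N. real (card (if i \<in> B then ?av T else {p. p permutes {..<n}}))) * fact ?N ^ n"
      unfolding BT(1) by (simp add: card_cartesian_product card_PiE card_permutations)
    have "(\<Prod>i<?N. real (card (if i \<in> B then ?av T else {p. p permutes {..<n}})))
        \<le> (\<Prod>i<?N. fact n * (if i \<in> B then \<theta> ^ k else 1))"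
      using av[OF BT(3,5)] by (intro prod_mono) (auto simp: card_permutations)
    also have "\<dots> = fact n ^ ?N * \<theta> ^ (k * card B)"
    proof -
      have "{..<?N} \<inter> B = B" using BT(2) by auto
      then show ?thesis by (simp add: prod.distrib prod.If_cases power_mult)
    qed
    also have "\<theta> ^ (k * card B) = \<theta> powr (real k * real (card B))"
      using assms(2) by (simp flip: powr_realpow)
    also have "fact n ^ ?N * \<theta> powr (real k * real (card B)) \<le> fact n ^ ?N * \<theta> powr (real k * b)"
      using assms(2,3) BT(4) by (intro mult_left_mono powr_mono') auto
    finally have "real (card (?F u)) \<le> (fact n ^ ?N * \<theta> powr (real k * b)) * fact ?N ^ n"
      unfolding card_F by (rule mult_right_mono) simp
    then show ?thesis by (simp add: card_profiles mult_ac)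
  qed
  have "avoiding_profiles n q k b (\<tau> * real n) \<subseteq> (\<Union>u\<in>?Z. ?F u)"
  proof
    fix z assume "z \<in> avoiding_profiles n q k b (\<tau> * real n)"
    then obtain P Q B T where z: "z = (P, Q)" "(P, Q) \<in> profiles n q"
      and BT: "(B, T) \<in> ?Z" "\<forall>i\<in>B. \<forall>j<k. P i j \<notin> T"
      unfolding avoiding_profiles_def by blast
    have "P i j < n" if "i < ?N" "j < k" for i j
      using profiles_choice_less[OF z(2) that(1)] that(2) assms(1) by simp
    then have "z \<in> ?F (B, T)" using z BT by (auto simp: profiles_def PiE_iff)
    then show "z \<in> (\<Union>u\<in>?Z. ?F u)" using BT(1) by blast
  qed
  then have "card (avoiding_profiles n q k b (\<tau> * real n)) \<le> card (\<Union>u\<in>?Z. ?F u)"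
    by (intro card_mono finite_UN_I finZ finF)
  also have "\<dots> \<le> (\<Sum>u\<in>?Z. card (?F u))" by (intro card_UN_le finZ)
  finally have "real (card (avoiding_profiles n q k b (\<tau> * real n))) \<le> (\<Sum>u\<in>?Z. real (card (?F u)))"
    by (simp only: of_nat_sum[symmetric] of_nat_le_iff)
  also have "\<dots> \<le> (\<Sum>u\<in>?Z. real (card (profiles n q)) * \<theta> powr (real k * b))"
    by (intro sum_mono one)
  also have "\<dots> = real (card ?Z) * (real (card (profiles n q)) * \<theta> powr (real k * b))" by simp
  also have "\<dots> \<le> 2 ^ (?N + n) * (real (card (profiles n q)) * \<theta> powr (real k * b))"
  proof (rule mult_right_mono)
    have "card ?Z \<le> card (Pow {..<?N} \<times> Pow {..<n})" by (intro card_mono) auto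
    also have "\<dots> = 2 ^ (?N + n)" by (simp add: card_cartesian_product card_Pow power_add)
    finally have "real (card ?Z) \<le> real (2 ^ (?N + n))" by (rule of_nat_mono)
    then show "real (card ?Z) \<le> 2 ^ (?N + n)" by simp
  qed simp
  finally show ?thesis by (simp add: mult_ac)
qed

text \<open>If every school had rejected \<open>i\<close>, all \<open>n\<close> schools would hold
  \<open>q\<close> students each, which takes all \<open>n * q\<close> students although
  \<open>i\<close> holds no place.\<close>

lemma da_final_less:
  assumes PQ: "(P, Q) \<in> profiles n q" and i: "i < n * q"
  shows "da_final n q P Q i < n"
proof (rule ccontr)
  let ?N = "n * q"
  let ?r = "cap_final n ?N q P Q"
  assume "\<not> ?thesis"
  then have ri: "?r i = n" using cap_final_le[of n ?N q P Q i] by (simp add: da_final_eq_cap_final)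
  have hq: "card (holders n ?N P ?r s) = q" if "s < n" for s
  proof -
    have "s \<in> P i ` {..<n}" using permutes_image[OF profiles_permutes(1)[OF PQ i]] that by simp
    then obtain j where "j < n" "s = P i j" by auto
    then show ?thesis
      using rejecter_final(1)[where c=n and P=P and Q=Q, OF profiles_inj_priority[OF PQ] i] ri by simp
  qed
  have "?N = (\<Sum>s<n. card (holders n ?N P ?r s))" using hq by simp
  also have "\<dots> = card (\<Union>s<n. holders n ?N P ?r s)"
    by (rule card_UN_disjoint[symmetric]) (auto simp: holders_def)
  also have "\<dots> \<le> card ({..<?N} - {i})"
    using ri by (intro card_mono) (auto simp: holders_def)
  also have "\<dots> < ?N" using i by simp
  finally show False by simp
qed

text \<open>A balanced envy-closed set \<open>A\<close> would yield an excluded pair: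
  \<open>B\<close> are its members with at least \<open>k\<close> rejections, \<open>T\<close> the
  schools attended outside \<open>A\<close>. A member of \<open>B\<close> prefers each of her first
  \<open>k\<close> schools to her own, so she would envy a student placed there.\<close>

lemma large_scc_if_not_avoiding:
  assumes PQ: "(P, Q) \<in> profiles n q" and pos: "0 < q" "0 < n" and \<epsilon>: "0 < \<epsilon>" "\<epsilon> \<le> 1" and K: "K \<le> n"
    and low: "real (card {i. i < n * q \<and> cap_final K (n * q) q P Q i < k}) < \<epsilon> / 6 * real (n * q)"
    and nav: "(P, Q) \<notin> avoiding_profiles n q k (\<epsilon> / 6 * real (n * q)) (\<epsilon> / 3 * real n)"
  shows "\<exists>C. is_scc {..<n * q} (envy_edges n q P Q) C \<and> (1 - \<epsilon>) * real n * real q \<le> real (card C)"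
proof -
  let ?N = "n * q" and ?E = "envy_edges n q P Q"
  let ?r = "da_final n q P Q"
  \<comment> \<open>The loss \<open>2 * a\<close> stays below \<open>\<epsilon> * N\<close>, and
    half of \<open>a\<close> may be lost to students with few rejections.\<close>
  define a where "a = \<epsilon> / 3 * real ?N"
  have N0: "0 < ?N" using pos by simp
  note inj = profiles_inj_priority[OF PQ]
  have rank: "inv (P i) (P i j) = j" if "i < ?N" for i j
    using permutes_inverses(2)[OF profiles_permutes(1)[OF PQ that]] .
  have "\<exists>C. is_scc {..<?N} ?E C \<and> real (card {..<?N}) - 2 * a \<le> real (card C)"
  proof (rule large_scc_if_no_balanced_closed_set)
    show "{..<?N} \<noteq> {}" using N0 by (metis lessThan_iff empty_iff)
    show "0 < a" using \<epsilon> N0 unfolding a_def by (intro mult_pos_pos) auto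
    have "\<epsilon> * real ?N \<le> 1 * real ?N" using \<epsilon> by (intro mult_right_mono) auto
    then show "3 * a \<le> real (card {..<?N})" by (simp add: a_def)
    fix A assume A: "A \<subseteq> {..<?N}"
      and closed: "\<And>x y. x \<in> A \<Longrightarrow> y \<in> {..<?N} \<Longrightarrow> (x, y) \<in> ?E \<Longrightarrow> y \<in> A"
      and lo: "a \<le> real (card A)" and hi: "real (card A) \<le> real (card {..<?N}) - a"
    have finA: "finite A" using A finite_subset by blast
    define B where "B = {i \<in> A. k \<le> ?r i}"
    define T where "T = DA n q P Q ` ({..<?N} - A)"
    have "B \<subseteq> {..<?N}" using A by (auto simp: B_def)
    moreover have "T \<subseteq> {..<n}"
      using da_final_less[OF PQ] profiles_choice_less[OF PQ] by (auto simp: T_def DA_def)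
    moreover have "\<epsilon> / 6 * real ?N \<le> real (card B)"
    proof -
      have sub: "A \<subseteq> B \<union> {i. i < ?N \<and> cap_final K ?N q P Q i < k}"
      proof
        fix i assume i: "i \<in> A"
        \<comment> \<open>The estimate for lists cut at \<open>K\<close> carries over, since full
          lists give at least as many rejections.\<close>
        have "cap_final K ?N q P Q i \<le> ?r i"
          unfolding da_final_eq_cap_final by (rule cap_final_mono[where N = ?N, OF _ K]) (rule inj)
        then show "i \<in> B \<union> {i. i < ?N \<and> cap_final K ?N q P Q i < k}"
          using i A by (auto simp: B_def)
      qed
      have "card A \<le> card (B \<union> {i. i < ?N \<and> cap_final K ?N q P Q i < k})"
        using finA by (intro card_mono sub) (auto simp: B_def)
      also have "\<dots> \<le> card B + card {i. i < ?N \<and> cap_final K ?N q P Q i < k}" by (rule card_Un_le)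
      finally have "real (card A) \<le> real (card B) + real (card {i. i < ?N \<and> cap_final K ?N q P Q i < k})"
        by linarith
      then show ?thesis using low lo unfolding a_def by linarith
    qed
    moreover have "\<epsilon> / 3 * real n \<le> real (card T)"
    proof -
      have finT: "finite T" by (simp add: T_def)
      have sub: "{..<?N} - A \<subseteq> (\<Union>s\<in>T. holders n ?N P ?r s)"
        using da_final_less[OF PQ] by (auto simp: T_def holders_def DA_def)
      have "card ({..<?N} - A) \<le> card (\<Union>s\<in>T. holders n ?N P ?r s)"
        using finT by (intro card_mono sub) auto
      also have "\<dots> \<le> (\<Sum>s\<in>T. card (holders n ?N P ?r s))" by (rule card_UN_le[OF finT])
      also have "\<dots> \<le> (\<Sum>s\<in>T. q)"
        unfolding da_final_eq_cap_final by (intro sum_mono card_holders_final_le inj) auto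
      finally have "card ({..<?N} - A) \<le> card T * q" by simp
      then have "real (card ({..<?N} - A)) \<le> real (card T) * real q" by (simp flip: of_nat_mult)
      moreover have "real (card ({..<?N} - A)) = real ?N - real (card A)"
        using A finA card_mono[of "{..<?N}" A] by (simp add: card_Diff_subset of_nat_diff del: of_nat_mult)
      ultimately have "a \<le> real (card T) * real q" using hi by simp
      then have "(\<epsilon> / 3 * real n) * real q \<le> real (card T) * real q" by (simp add: a_def)
      then show ?thesis using pos by (simp add: mult_le_cancel_right)
    qed
    moreover have "P i j \<notin> T" if ij: "i \<in> B" "j < k" for i j
    proof
      assume "P i j \<in> T"
      then obtain l where l: "l < ?N" "l \<notin> A" "P i j = DA n q P Q l" by (auto simp: T_def)
      have i: "i \<in> A" "i < ?N" "k \<le> ?r i" using ij A by (auto simp: B_def)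
      have "inv (P i) (DA n q P Q l) = j" using rank[OF i(2), of j] l(3) by simp
      moreover have "inv (P i) (DA n q P Q i) = ?r i" using rank[OF i(2)] by (simp add: DA_def)
      ultimately have "(i, l) \<in> ?E" using i l ij by (simp add: envy_edges_def)
      then show False using closed[of i l] i l by simp
    qed
    ultimately show False using nav PQ unfolding avoiding_profiles_def by blast
  qed simp
  then obtain C where C: "is_scc {..<?N} ?E C" "real ?N - 2 * a \<le> real (card C)" by auto
  have "(1 - \<epsilon>) * real n * real q \<le> real ?N - 2 * a"
    using \<epsilon> by (simp add: a_def algebra_simps)
  then show ?thesis using C by (intro exI[of _ C]) auto
qed

section \<open>Limits\<close>

lemma cube_times_power_tendsto_0:
  fixes a c :: real
  assumes "0 < a" "0 < c" "c < 1"
  shows "(\<lambda>n. (a * real n + 1) ^ 3 * c ^ n) \<longlonglongrightarrow> 0"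
  using assms by real_asymp

lemma exists_power_small:
  fixes x y :: real
  assumes "0 < x" "x < 1" "0 < y"
  shows "\<exists>k>0. x ^ k < y"
proof -
  obtain k where "x ^ k < y" using real_arch_pow_inv[OF assms(3,2)] by blast
  moreover have "x ^ Suc k \<le> x ^ k" using assms by (intro power_decreasing) auto
  ultimately show ?thesis by (intro exI[of _ "Suc k"]) auto
qed

lemma exists_small_powr:
  fixes a \<gamma> y :: real
  assumes "0 < a" "0 < \<gamma>" "0 < y"
  shows "\<exists>m::nat. a \<le> real m \<and> (a / real m) powr \<gamma> \<le> y"
proof -
  obtain m :: nat where m: "max a (a / y powr (1 / \<gamma>)) \<le> real m" using real_arch_simple by blast
  have m0: "0 < real m" using m assms by linarith
  have "a / real m \<le> y powr (1 / \<gamma>)" using m m0 assms by (simp add: field_simps)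
  then have "(a / real m) powr \<gamma> \<le> (y powr (1 / \<gamma>)) powr \<gamma>"
    using assms m0 by (intro powr_mono2) auto
  also have "\<dots> = y" using assms by (simp add: powr_powr)
  finally show ?thesis using m by (intro exI[of _ m]) auto
qed

lemma exists_exponent:
  fixes t :: real
  assumes "0 < t" "t < 1"
  shows "\<exists>\<beta>>0. (1 / t) powr \<beta> * (1 - t) < 1"
proof -
  \<comment> \<open>With this exponent \<open>(1 / t) powr ?\<beta>\<close> is the inverse square
    root of \<open>1 - t\<close>, so the product is its square root.\<close>
  let ?\<beta> = "ln (1 - t) / (2 * ln t)"
  have neg: "ln (1 - t) < 0" "ln t < 0" using assms by auto
  have "(1 / t) powr ?\<beta> = exp (- ln (1 - t) / 2)"
    using assms neg by (simp add: powr_def ln_div field_simps)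
  then have "(1 / t) powr ?\<beta> * (1 - t) = exp (- ln (1 - t) / 2) * exp (ln (1 - t))"
    using assms by simp
  also have "\<dots> = exp (ln (1 - t) / 2)" by (simp add: exp_add[symmetric])
  also have "\<dots> < 1" using neg by simp
  finally show ?thesis using neg by (intro exI[of _ ?\<beta>]) (auto simp: zero_less_divide_iff)
qed

text \<open>The constants are chosen in the order \<open>lam\<close>, \<open>t\<close>,
  \<open>\<beta>\<close>, \<open>K\<close>, none depending on \<open>n\<close>: \<open>lam\<close>
  makes the second summand of \<open>low_rank_probability_le\<close> exponentially small, the others
  the first, and the cubic prefactor is then harmless.\<close>

lemma low_rank_probability_tendsto_0:
  fixes \<delta> :: real
  assumes q: "0 < q" and k: "0 < k" and \<delta>: "0 < \<delta>"
  shows "\<exists>K. (\<lambda>n. real (card {(P, Q) \<in> profiles n q. \<delta> * real (n * q)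
             \<le> real (card {i. i < n * q \<and> cap_final K (n * q) q P Q i < k})})
           / real (card (profiles n q))) \<longlonglongrightarrow> 0"
proof -
  obtain lam :: nat where lam: "real (k * q) \<le> real lam"
    "(real (k * q) / real lam) powr (\<delta> * real q) \<le> 1 / 2 ^ (q + 1)"
    using exists_small_powr[of "real (k * q)" "\<delta> * real q" "1 / 2 ^ (q + 1)"] q k \<delta> by auto
  \<comment> \<open>Half the lower bound for the probability of an empty bin, so that
    \<open>t + (1 - exp (-2) ^ lam)\<close> becomes \<open>1 - t\<close>.\<close>
  define t :: real where "t = exp (-2) ^ lam / 2"
  have e1: "exp (-2) ^ lam \<le> (1::real)" by (intro power_le_one) auto
  have t: "0 < t" "t < 1" using e1 by (auto simp: t_def)
  have ta: "t + (1 - exp (-2) ^ lam) = 1 - t" by (simp add: t_def)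
  obtain \<beta> where \<beta>: "0 < \<beta>" "(1 / t) powr \<beta> * (1 - t) < 1" using exists_exponent[OF t] by blast
  obtain K0 :: nat where "real lam / \<beta> \<le> real K0" using real_arch_simple by blast
  define K where "K = max K0 k"
  have K: "0 < K" "k \<le> K" using k by (auto simp: K_def)
  have lamK: "real lam \<le> \<beta> * real K"
  proof -
    have "real lam \<le> \<beta> * real K0" using \<open>real lam / \<beta> \<le> real K0\<close> \<beta>(1) by (simp add: field_simps)
    also have "\<dots> \<le> \<beta> * real K" using \<beta>(1) by (intro mult_left_mono) (auto simp: K_def)
    finally show ?thesis .
  qed
  let ?y = "(1 / t) powr \<beta> * (1 - t)"
  let ?z = "2 ^ q * (real (k * q) / real lam) powr (\<delta> * real q)"
  let ?bad = "\<lambda>n. {(P, Q) \<in> profiles n q. \<delta> * real (n * q)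
             \<le> real (card {i. i < n * q \<and> cap_final K (n * q) q P Q i < k})}"
  \<comment> \<open>A common base below 1 for both exponentials; \<open>?z\<close> is at most 1/2 by
    the choice of \<open>lam\<close>.\<close>
  define c where "c = max ?y (1 / 2)"
  have c: "0 < c" "c < 1" using \<beta> by (auto simp: c_def)
  have zc: "?z \<le> c"
  proof -
    have "?z \<le> 2 ^ q * (1 / 2 ^ (q + 1))" using lam(2) by (intro mult_left_mono) auto
    then show ?thesis by (simp add: c_def)
  qed
  define E where "E = exp (2 * real K ^ 2 * real q)"
  define d where "d = real (K * q)"
  have d: "0 < d" using K q by (simp add: d_def)
  have bound: "real (card (?bad n)) / real (card (profiles n q)) \<le> 2 * E * ((d * real n + 1) ^ 3 * c ^ n)"
    if n: "max 2 (2 * K) \<le> n" for n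
  proof -
    have P: "0 < real (card (profiles n q))" by (simp add: card_profiles)
    have kl: "k * q \<le> lam" using lam(1) by (simp only: of_nat_le_iff)
    have "real (card (?bad n)) \<le> real (card (profiles n q)) *
        (E * real (K * (n * q) + 1) ^ 3 * (?y ^ n + ?z ^ n))"
      using low_rank_probability_le[OF refl q _ K(1) _ k K(2) t(1) _ lamK kl, of n \<delta>] n t(2)
      unfolding ta E_def by simp
    then have "real (card (?bad n)) / real (card (profiles n q))
        \<le> E * real (K * (n * q) + 1) ^ 3 * (?y ^ n + ?z ^ n)"
      using P by (simp only: pos_divide_le_eq mult.commute)
    also have "\<dots> \<le> E * real (K * (n * q) + 1) ^ 3 * (c ^ n + c ^ n)"
      using zc t by (intro mult_left_mono add_mono power_mono) (auto simp: E_def c_def)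
    also have "real (K * (n * q) + 1) = d * real n + 1" by (simp add: d_def)
    finally show ?thesis by (simp add: mult_ac)
  qed
  have lim: "(\<lambda>n. 2 * E * ((d * real n + 1) ^ 3 * c ^ n)) \<longlonglongrightarrow> 0"
    using tendsto_mult_left[OF cube_times_power_tendsto_0[OF d c], of "2 * E"] by simp
  have "(\<lambda>n. real (card (?bad n)) / real (card (profiles n q))) \<longlonglongrightarrow> 0"
  proof (rule tendsto_sandwich[OF _ _ tendsto_const lim])
    show "\<forall>\<^sub>F n in sequentially. real (card (?bad n)) / real (card (profiles n q))
        \<le> 2 * E * ((d * real n + 1) ^ 3 * c ^ n)"
      by (rule eventually_sequentiallyI) (rule bound)
  qed simp
  then show ?thesis by (intro exI[of _ K])
qed

lemma avoiding_probability_tendsto_0: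
  fixes b \<tau> :: real
  assumes q: "0 < q" and b: "0 < b" and \<tau>: "0 < \<tau>" "\<tau> < 1"
  shows "\<exists>k>0. (\<lambda>n. real (card (avoiding_profiles n q k (b * real (n * q)) (\<tau> * real n)))
           / real (card (profiles n q))) \<longlonglongrightarrow> 0"
proof -
  \<comment> \<open>Strictly between \<open>1 - \<tau>\<close> and 1, which leaves room to replace
    \<open>n\<close> by \<open>n - k\<close> for large \<open>n\<close>.\<close>
  define \<theta> where "\<theta> = 1 - \<tau> / 2"
  have \<theta>: "0 < \<theta>" "\<theta> < 1" using \<tau> by (auto simp: \<theta>_def)
  have bq: "0 < b * real q" using b q by simp
  have x: "0 < \<theta> powr (b * real q)" "\<theta> powr (b * real q) < 1"
    using \<theta> bq powr_less_mono'[of \<theta> 0 "b * real q"] by auto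
  \<comment> \<open>Large enough to beat the factor \<open>2 ^ (q + 1)\<close> per school in the
    union bound, with ratio below 1/2.\<close>
  obtain k where k: "0 < k" "(\<theta> powr (b * real q)) ^ k < 1 / 2 ^ (q + 2)"
    using exists_power_small[OF x, of "1 / 2 ^ (q + 2)"] by auto
  let ?bad = "\<lambda>n. avoiding_profiles n q k (b * real (n * q)) (\<tau> * real n)"
  have bound: "real (card (?bad n)) / real (card (profiles n q)) \<le> (1 / 2) ^ n"
    if n: "k + nat \<lceil>2 * real k / \<tau>\<rceil> < n" for n
  proof -
    have P: "0 < real (card (profiles n q))" by (simp add: card_profiles)
    have kn: "k < n" using n by simp
    have "2 * real k / \<tau> \<le> real n" using n by linarith
    then have kt: "2 * real k \<le> \<tau> * real n" using \<tau> by (simp add: field_simps)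
    have "\<theta> * real k \<le> 1 * real k" using \<theta> by (intro mult_right_mono) auto
    moreover have "\<theta> * real (n - k) = \<theta> * real n - \<theta> * real k"
      using kn by (simp add: of_nat_diff right_diff_distrib)
    moreover have "\<theta> * real n = real n - \<tau> * real n / 2" "(1 - \<tau>) * real n = real n - \<tau> * real n"
      by (simp_all add: \<theta>_def left_diff_distrib)
    ultimately have th: "(1 - \<tau>) * real n \<le> \<theta> * real (n - k)" using kt by linarith
    have "real (card (?bad n)) \<le> real (card (profiles n q)) *
        (2 ^ (n * q + n) * \<theta> powr (real k * (b * real (n * q))))"
      using card_avoiding_profiles_le[OF kn \<theta>(1) _ th] \<theta>(2) by simp
    also have "\<theta> powr (real k * (b * real (n * q))) = ((\<theta> powr (b * real q)) ^ k) ^ n"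
    proof -
      have "((\<theta> powr (b * real q)) ^ k) ^ n = (\<theta> powr (b * real q)) ^ (k * n)" by (simp only: power_mult)
      also have "\<dots> = (\<theta> powr (b * real q)) powr real (k * n)"
        using x(1) by (simp only: powr_realpow)
      also have "\<dots> = \<theta> powr (real k * (b * real (n * q)))"
        by (simp add: powr_powr mult_ac)
      finally show ?thesis by simp
    qed
    also have "(2::real) ^ (n * q + n) = (2 ^ (q + 1)) ^ n" by (simp add: power_mult[symmetric] power_add[symmetric] mult.commute)
    also have "(2 ^ (q + 1)) ^ n * ((\<theta> powr (b * real q)) ^ k) ^ n
        = (2 ^ (q + 1) * (\<theta> powr (b * real q)) ^ k) ^ n" by (simp only: power_mult_distrib)
    finally have "real (card (?bad n)) / real (card (profiles n q))
        \<le> (2 ^ (q + 1) * (\<theta> powr (b * real q)) ^ k) ^ n"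
      using P by (simp only: pos_divide_le_eq mult.commute)
    also have "\<dots> \<le> (1 / 2) ^ n"
    proof (rule power_mono)
      have "2 ^ (q + 1) * (\<theta> powr (b * real q)) ^ k \<le> 2 ^ (q + 1) * (1 / 2 ^ (q + 2))"
        using k(2) by (intro mult_left_mono) auto
      then show "2 ^ (q + 1) * (\<theta> powr (b * real q)) ^ k \<le> 1 / 2" by simp
    qed simp
    finally show ?thesis .
  qed
  have lim: "(\<lambda>n. (1 / 2 :: real) ^ n) \<longlonglongrightarrow> 0" by (rule LIMSEQ_realpow_zero) auto
  have "(\<lambda>n. real (card (?bad n)) / real (card (profiles n q))) \<longlonglongrightarrow> 0"
  proof (rule tendsto_sandwich[OF _ _ tendsto_const lim])
    show "\<forall>\<^sub>F n in sequentially. real (card (?bad n)) / real (card (profiles n q)) \<le> (1 / 2) ^ n"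
      by (rule eventually_sequentiallyI[of "Suc (k + nat \<lceil>2 * real k / \<tau>\<rceil>)"])
        (rule bound, linarith)
  qed simp
  then show ?thesis using k(1) by blast
qed

theorem mainTheorem11:
  fixes q :: nat and \<epsilon> :: real
  assumes "q > 0" and "\<epsilon> > 0"
  shows "(\<lambda>n. real (card {(P, Q) \<in> profiles n q.
              \<exists>C. is_scc {..<n*q} (envy_edges n q P Q) C \<and>
                  real (card C) \<ge> (1 - \<epsilon>) * real n * real q})
            / real (card (profiles n q))) \<longlonglongrightarrow> 1"
proof -
  \<comment> \<open>\<open>large_scc_if_not_avoiding\<close> is stated for proportions up to 1; a
    larger \<open>\<epsilon>\<close> only weakens the claim.\<close>
  define e where "e = min \<epsilon> 1"
  have e: "0 < e" "e \<le> 1" "e \<le> \<epsilon>" using assms by (auto simp: e_def)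
  let ?good = "\<lambda>n. {(P, Q) \<in> profiles n q. \<exists>C. is_scc {..<n*q} (envy_edges n q P Q) C \<and>
                  real (card C) \<ge> (1 - \<epsilon>) * real n * real q}"
  let ?p = "\<lambda>n. real (card (profiles n q))"
  \<comment> \<open>The avoidance bound fixes \<open>k\<close> first; the truncation length
    \<open>K\<close> then depends on it.\<close>
  obtain k where k: "0 < k"
    and lim_av: "(\<lambda>n. real (card (avoiding_profiles n q k (e / 6 * real (n * q)) (e / 3 * real n))) / ?p n) \<longlonglongrightarrow> 0"
    using avoiding_probability_tendsto_0[OF assms(1), of "e / 6" "e / 3"] e by auto
  obtain K where lim_low: "(\<lambda>n. real (card {(P, Q) \<in> profiles n q. e / 6 * real (n * q)
             \<le> real (card {i. i < n * q \<and> cap_final K (n * q) q P Q i < k})}) / ?p n) \<longlonglongrightarrow> 0"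
    using low_rank_probability_tendsto_0[OF assms(1) k, of "e / 6"] e by auto
  let ?av = "\<lambda>n. avoiding_profiles n q k (e / 6 * real (n * q)) (e / 3 * real n)"
  let ?low = "\<lambda>n. {(P, Q) \<in> profiles n q. e / 6 * real (n * q)
             \<le> real (card {i. i < n * q \<and> cap_final K (n * q) q P Q i < k})}"
  have p: "0 < ?p n" for n by (simp add: card_profiles)
  have upper: "real (card (?good n)) / ?p n \<le> 1" for n
  proof -
    have "card (?good n) \<le> card (profiles n q)" by (intro card_mono finite_profiles) auto
    then show ?thesis using p[of n] by (simp add: divide_le_eq)
  qed
  have lower: "1 - real (card (?av n)) / ?p n - real (card (?low n)) / ?p n \<le> real (card (?good n)) / ?p n"
    if n: "max 1 K \<le> n" for n
  proof -
    have fin: "finite (?good n)" "finite (?av n)" "finite (?low n)"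
      by (rule finite_subset[OF _ finite_profiles[of n q]], auto simp: avoiding_profiles_def)+
    have "profiles n q \<subseteq> ?good n \<union> (?av n \<union> ?low n)"
    proof
      fix z assume z: "z \<in> profiles n q"
      obtain P Q where PQ: "z = (P, Q)" by force
      show "z \<in> ?good n \<union> (?av n \<union> ?low n)"
      proof (rule ccontr)
        assume "z \<notin> ?good n \<union> (?av n \<union> ?low n)"
        then have ng: "z \<notin> ?good n" and "z \<notin> ?av n" "z \<notin> ?low n" by blast+
        then have "\<exists>C. is_scc {..<n * q} (envy_edges n q P Q) C \<and> (1 - e) * real n * real q \<le> real (card C)"
          using large_scc_if_not_avoiding[of P Q n q e K k] z n e assms(1) unfolding PQ by auto
        then obtain C where C: "is_scc {..<n * q} (envy_edges n q P Q) C"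
          "(1 - e) * real n * real q \<le> real (card C)" by blast
        have "(1 - \<epsilon>) * real n * real q \<le> (1 - e) * real n * real q"
          using e(3) by (intro mult_right_mono) auto
        then have "z \<in> ?good n" using C z PQ by auto
        then show False using ng by blast
      qed
    qed
    then have "card (profiles n q) \<le> card (?good n \<union> (?av n \<union> ?low n))"
      using fin by (intro card_mono) auto
    also have "\<dots> \<le> card (?good n) + (card (?av n) + card (?low n))"
      by (rule order.trans[OF card_Un_le]) (intro add_left_mono card_Un_le)
    finally have "?p n \<le> real (card (?good n)) + (real (card (?av n)) + real (card (?low n)))"
      by linarith
    then have "?p n / ?p n \<le> (real (card (?good n)) + (real (card (?av n)) + real (card (?low n)))) / ?p n"
      by (intro divide_right_mono) auto
    then show ?thesis using p[of n] by (simp add: add_divide_distrib)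
  qed
  have lim: "(\<lambda>n. 1 - real (card (?av n)) / ?p n - real (card (?low n)) / ?p n) \<longlonglongrightarrow> 1"
    using tendsto_diff[OF tendsto_diff[OF tendsto_const[of 1] lim_av] lim_low] by simp
  show ?thesis
  proof (rule tendsto_sandwich[OF _ _ lim tendsto_const])
    show "\<forall>\<^sub>F n in sequentially. 1 - real (card (?av n)) / ?p n - real (card (?low n)) / ?p n
        \<le> real (card (?good n)) / ?p n"
      by (rule eventually_sequentiallyI) (rule lower)
    show "\<forall>\<^sub>F n in sequentially. real (card (?good n)) / ?p n \<le> 1"
      by (rule always_eventually) (rule allI, rule upper)
  qed
qed

end
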